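(* Let $(L,\mathbb{F})$ be a Lévy process on $(\Omega,\mathscr{F},\mathbb{P};\mathbb{F})$ with finite horizon $T>0$, let $\varphi_T(\kappa)=\mathbb{E}_{\mathbb{P}}[\exp(\kappa L_T)]$, and suppose that $\{\kappa\in\mathbb{R}:\ \varphi_T(\kappa)<+\infty\}=\{0\}$. Then the following conditions are equivalent: (i) The minimal entropy martingale measure (MEMM) $\mathbb{P}^*$ in $\hat{\mathscr{M}}^{\rm loc}_a$ exists and is equal to the Esscher martingale measure (EMM) $\mathbb{P}^E$. (ii) $\mathbb{P}$ is a martingale measure for $(L,\mathbb{F})$. (iii) $\mathbb{E}_{\mathbb{P}}[L_t]=0$ for $t=T$, and hence for all $t\in[0,T]$. (iv) The EMM $\mathbb{P}^E$ exists and is equal to $\mathbb{P}$. If one, and therefore all, of the conditions (i)–(iv) is satisfied, then $\mathbb{P}$ is the MEMM in $\hat{\mathscr{M}}^{\rm loc}_a$. Otherwise, the MEMM in the class $\hat{\mathscr{M}}^{\rm loc}_a$ and the EMM do not exist.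
   Context: Time runs over $[0,T]$, $\mathbb{F}=(\mathscr{F}_t)_{t\in[0,T]}$, and $(L,\mathbb{F})$ is a real-valued Lévy process with respect to $\mathbb{F}$ under $\mathbb{P}$ (càdlàg, $L_0=0$, $\mathbb{F}$-adapted, stationary increments $L_t-L_s$ independent of $\mathscr{F}_s$). Probability measures below are considered on $\mathscr{F}_T$. Relative entropy: $I_T(\mathbb{Q},\mathbb{P})=\mathbb{E}_{\mathbb{P}}\big[\frac{d\mathbb{Q}}{d\mathbb{P}}|_{\mathscr{F}_T}\log\frac{d\mathbb{Q}}{d\mathbb{P}}|_{\mathscr{F}_T}\big]$ if $\mathbb{Q}|_{\mathscr{F}_T}\ll\mathbb{P}|_{\mathscr{F}_T}$, and $+\infty$ otherwise. Classes (all measures $\mathbb{Q}$ satisfy $\mathbb{Q}|_{\mathscr{F}_T}\ll\mathbb{P}|_{\mathscr{F}_T}$): - $\mathscr{M}^{\rm loc}_a$: $(L,\mathbb{F})$ is a $\mathbb{Q}$-local martingale. - $\tilde{\mathscr{M}}^{\rm loc,0}_a$: $\mathbb{E}_{\mathbb{Q}}[|L_T|]<+\infty$ and there is a sequence $(\tau_k)_{k\ge1}$ of $\mathbb{F}$-stopping times such that $\{\tau_k=T\}\uparrow\Omega$ as $k\to\infty$ and $\mathbb{E}_{\mathbb{Q}}[L_{\tau_k\wedge T}]=0$ for all $k\ge1$. - $\hat{\mathscr{M}}^{\rm loc}_a=\mathscr{M}^{\rm loc}_a\cup\tilde{\mathscr{M}}^{\rm loc,0}_a$. A MEMM in a class $\mathscr{C}$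 is a $\mathbb{P}^*\in\mathscr{C}$ with $I_T(\mathbb{P}^*,\mathbb{P})=\inf_{\mathbb{Q}\in\mathscr{C}}I_T(\mathbb{Q},\mathbb{P})$. "$\mathbb{P}$ is a martingale measure for $(L,\mathbb{F})$" means that $(L,\mathbb{F})$ is a $\mathbb{P}$-martingale. The statement $\mathbb{E}_{\mathbb{P}}[L_t]=0$ includes integrability of $L_t$. For $\kappa\in\mathbb{R}$ with $\varphi_T(\kappa)<\infty$, the Esscher measure $\mathbb{P}^\kappa$ is defined by $d\mathbb{P}^\kappa=\frac{\exp(\kappa L_T)}{\varphi_T(\kappa)}\,d\mathbb{P}$. If $(L,\mathbb{F})$ is a martingale under $\mathbb{P}^{\kappa}$ for some such $\kappa$, then $\mathbb{P}^\kappa$ is called the EMM and denoted $\mathbb{P}^E$. *)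

theory Defs
  imports "HOL-Probability.Probability"
begin

(* Processes and filtrations are indexed by the reals; only their values at times in {0..T}
   are ever used.  Of F t only the space and the sigma-algebra matter (subalgebra). *)

definition cadlag_on :: "real \<Rightarrow> (real \<Rightarrow> real) \<Rightarrow> bool" where
  "cadlag_on T f \<longleftrightarrow>
     (\<forall>t\<in>{0..<T}. continuous (at_right t) f) \<and>
     (\<forall>t\<in>{0<..T}. \<exists>l. (f \<longlongrightarrow> l) (at_left t))"

(* No usual conditions are imposed on F.  Stationarity is stated against L (t - s) because
   L 0 = 0. *)
locale levy_process = prob_space M
  for M :: "'a measure" and F :: "real \<Rightarrow> 'a measure" and T :: real
    and L :: "real \<Rightarrow> 'a \<Rightarrow> real" +
  assumes horizon_pos: "0 < T"
    and subalgebra_F: "\<And>t. t \<in> {0..T} \<Longrightarrow> subalgebra M (F t)"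
    and F_mono: "\<And>s t. 0 \<le> s \<Longrightarrow> s \<le> t \<Longrightarrow> t \<le> T \<Longrightarrow> sets (F s) \<subseteq> sets (F t)"
    and adapted: "\<And>t. t \<in> {0..T} \<Longrightarrow> L t \<in> borel_measurable (F t)"
    and cadlag_paths: "\<And>\<omega>. \<omega> \<in> space M \<Longrightarrow> cadlag_on T (\<lambda>t. L t \<omega>)"
    and start_zero: "\<And>\<omega>. \<omega> \<in> space M \<Longrightarrow> L 0 \<omega> = 0"
    and stationary_increments: "\<And>s t. 0 \<le> s \<Longrightarrow> s \<le> t \<Longrightarrow> t \<le> T \<Longrightarrow>
      distr M borel (\<lambda>\<omega>. L t \<omega> - L s \<omega>) = distr M borel (L (t - s))"
    and independent_increments: "\<And>s t. 0 \<le> s \<Longrightarrow> s \<le> t \<Longrightarrow> t \<le> T \<Longrightarrow>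
      indep_set (sets (F s)) (sets (vimage_algebra (space M) (\<lambda>\<omega>. L t \<omega> - L s \<omega>) borel))"

definition martingale_on ::
  "'a measure \<Rightarrow> (real \<Rightarrow> 'a measure) \<Rightarrow> real \<Rightarrow> (real \<Rightarrow> 'a \<Rightarrow> real) \<Rightarrow> bool" where
  "martingale_on Q F T X \<longleftrightarrow>
     (\<forall>t\<in>{0..T}. X t \<in> borel_measurable (F t) \<and> integrable Q (X t)) \<and>
     (\<forall>s\<in>{0..T}. \<forall>t\<in>{s..T}. AE \<omega> in Q. real_cond_exp Q (F s) (X t) \<omega> = X s \<omega>)"

(* Stopping times take values in the time set {0..T}.  The range condition is imposed on the whole
   type, which loses nothing (a time can be set to T off the sample space) and makes the clauses of
   stopping_time at t outside {0..T} vacuous. *)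
definition stopping_time_on :: "(real \<Rightarrow> 'a measure) \<Rightarrow> real \<Rightarrow> ('a \<Rightarrow> real) \<Rightarrow> bool" where
  "stopping_time_on F T \<tau> \<longleftrightarrow> stopping_time F \<tau> \<and> range \<tau> \<subseteq> {0..T}"

definition local_martingale_on ::
  "'a measure \<Rightarrow> (real \<Rightarrow> 'a measure) \<Rightarrow> real \<Rightarrow> (real \<Rightarrow> 'a \<Rightarrow> real) \<Rightarrow> bool" where
  "local_martingale_on Q F T X \<longleftrightarrow>
     (\<exists>\<tau> :: nat \<Rightarrow> 'a \<Rightarrow> real.
        (\<forall>k. stopping_time_on F T (\<tau> k)) \<and>
        (\<forall>\<omega>\<in>space Q. incseq (\<lambda>k. \<tau> k \<omega>)) \<and>
        (AE \<omega> in Q. \<exists>k. \<tau> k \<omega> = T) \<and>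
        (\<forall>k. martingale_on Q F T (\<lambda>t \<omega>. X (min t (\<tau> k \<omega>)) \<omega>)))"

(* Expectation of Z log Z as positive minus negative part: the negative part is bounded when P
   is finite, so the difference is well defined in (-oo, oo]. *)
definition relative_entropy :: "'a measure \<Rightarrow> 'a measure \<Rightarrow> ereal" where
  "relative_entropy Q P =
     (if absolutely_continuous P Q then
        (let Z = (\<lambda>\<omega>. enn2real (RN_deriv P Q \<omega>)) in
          enn2ereal (\<integral>\<^sup>+ \<omega>. ennreal (Z \<omega> * ln (Z \<omega>)) \<partial>P) -
          enn2ereal (\<integral>\<^sup>+ \<omega>. ennreal (- (Z \<omega> * ln (Z \<omega>))) \<partial>P))
      else \<infinity>)"

(* Probability measures live on F T, so P enters through its restriction to F T. *)
abbreviation P_at :: "'a measure \<Rightarrow> (real \<Rightarrow> 'a measure) \<Rightarrow> real \<Rightarrow> 'a measure" where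
  "P_at M F T \<equiv> restr_to_subalg M (F T)"

definition ac_prob_measures :: "'a measure \<Rightarrow> (real \<Rightarrow> 'a measure) \<Rightarrow> real \<Rightarrow> 'a measure set" where
  "ac_prob_measures M F T =
     {Q. prob_space Q \<and> sets Q = sets (F T) \<and> absolutely_continuous (P_at M F T) Q}"

definition M_loc ::
  "'a measure \<Rightarrow> (real \<Rightarrow> 'a measure) \<Rightarrow> real \<Rightarrow> (real \<Rightarrow> 'a \<Rightarrow> real) \<Rightarrow> 'a measure set" where
  "M_loc M F T L = {Q \<in> ac_prob_measures M F T. local_martingale_on Q F T L}"

definition M_tilde_loc ::
  "'a measure \<Rightarrow> (real \<Rightarrow> 'a measure) \<Rightarrow> real \<Rightarrow> (real \<Rightarrow> 'a \<Rightarrow> real) \<Rightarrow> 'a measure set" where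
  "M_tilde_loc M F T L =
     {Q \<in> ac_prob_measures M F T.
        integrable Q (L T) \<and>
        (\<exists>\<tau> :: nat \<Rightarrow> 'a \<Rightarrow> real.
          (\<forall>k. stopping_time_on F T (\<tau> k)) \<and>
          incseq (\<lambda>k. {\<omega> \<in> space Q. \<tau> k \<omega> = T}) \<and>
          (\<Union>k. {\<omega> \<in> space Q. \<tau> k \<omega> = T}) = space Q \<and>
          (\<forall>k. integrable Q (\<lambda>\<omega>. L (min (\<tau> k \<omega>) T) \<omega>) \<and>
               (\<integral>\<omega>. L (min (\<tau> k \<omega>) T) \<omega> \<partial>Q) = 0))}"

definition M_hat_loc ::
  "'a measure \<Rightarrow> (real \<Rightarrow> 'a measure) \<Rightarrow> real \<Rightarrow> (real \<Rightarrow> 'a \<Rightarrow> real) \<Rightarrow> 'a measure set" where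
  "M_hat_loc M F T L = M_loc M F T L \<union> M_tilde_loc M F T L"

definition is_MEMM :: "'a measure \<Rightarrow> 'a measure set \<Rightarrow> 'a measure \<Rightarrow> bool" where
  "is_MEMM P C Q \<longleftrightarrow> Q \<in> C \<and> relative_entropy Q P = (INF R\<in>C. relative_entropy R P)"

definition exp_moment :: "'a measure \<Rightarrow> real \<Rightarrow> (real \<Rightarrow> 'a \<Rightarrow> real) \<Rightarrow> real \<Rightarrow> ennreal" where
  "exp_moment M T L \<kappa> = (\<integral>\<^sup>+ \<omega>. ennreal (exp (\<kappa> * L T \<omega>)) \<partial>M)"

definition esscher_measure ::
  "'a measure \<Rightarrow> (real \<Rightarrow> 'a measure) \<Rightarrow> real \<Rightarrow> (real \<Rightarrow> 'a \<Rightarrow> real) \<Rightarrow> real \<Rightarrow> 'a measure" where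
  "esscher_measure M F T L \<kappa> =
     density (P_at M F T) (\<lambda>\<omega>. ennreal (exp (\<kappa> * L T \<omega>)) / exp_moment M T L \<kappa>)"

definition is_EMM ::
  "'a measure \<Rightarrow> (real \<Rightarrow> 'a measure) \<Rightarrow> real \<Rightarrow> (real \<Rightarrow> 'a \<Rightarrow> real) \<Rightarrow> 'a measure \<Rightarrow> bool" where
  "is_EMM M F T L Q \<longleftrightarrow>
     (\<exists>\<kappa>. exp_moment M T L \<kappa> < \<infinity> \<and> Q = esscher_measure M F T L \<kappa> \<and> martingale_on Q F T L)"

end

theory Submission
  imports Defs
begin

text \<open>Write P for the restriction of M to F T. If no nonzero exponential moment of \<open>L T\<close> is finite,
then the relative entropies over the class have infimum 0, whatever the mean of \<open>L T\<close> is. To shift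
the mean by a fixed amount it suffices to move a mass of order \<open>1/n\<close> to the event
\<open>n < L T \<le> n + 1\<close> (or its mirror image, depending on the sign of the shift), and this costs entropy of order \<open>1/n\<close> times the negative logarithm of the
probability of that event. As exponential moments are infinite, these probabilities do not decay
exponentially, so for suitable large n the cost is as small as desired. Conditioning on \<open>L T\<close>
being bounded by a large constant and then correcting the mean in this way gives densities that
centre \<open>L T\<close> (\<open>exists_centring_density\<close>); with the constant stopping time T they lie in the class.

Since relative entropy vanishes only at P itself, a minimal entropy martingale measure exists exactly
if P belongs to the class, and then it is P. The only Esscher measure is the one with parameter 0,
which is P as well. It remains to show the equivalence of three properties: P belongs to the class,
P is a martingale measure, and \<open>L T\<close> is integrable with mean 0.

The substantial direction starts from a stopping time \<open>\<tau>\<close> with \<open>P(\<tau> < T)\<close> small and \<open>L \<tau>\<close>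
integrable with mean 0. The remainder \<open>L T - L \<tau>\<close> vanishes on \<open>\<tau> = T\<close>. By independence its
truncated absolute mean is at most \<open>P(\<tau> < T)\<close> times the sum of a constant and twice the one of
\<open>L T\<close> (\<open>truncated_remainder_bound\<close>); if \<open>P(\<tau> < T)\<close> is small, this can be absorbed, which makes \<open>L T\<close>
integrable. The expectation of \<open>L \<tau>\<close> is then the mean of \<open>L T\<close> times \<open>E \<tau> / T\<close>
(\<open>wald_identity\<close>), and so the mean of \<open>L T\<close> is 0. In both steps the stopping time is approximated
from the right by times with values in a finite grid. Independence of increments is then applied at
the deterministic grid points, one cell of constancy at a time, and right-continuity of the paths
passes to the limit.\<close>

section \<open>Independence and convergence in a probability space\<close>

text \<open>Conditioning on an event independent of X leaves the law of X unchanged. The product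
formulas for integrals over the event are read off from this identity of measures.\<close>
lemma (in prob_space) distr_density_indicator_indep:
  fixes X :: "'a \<Rightarrow> real"
  assumes A: "A \<in> events" and X [measurable]: "X \<in> borel_measurable M"
    and indep: "\<And>B. B \<in> sets borel \<Longrightarrow>
      prob (A \<inter> {\<omega>\<in>space M. X \<omega> \<in> B}) = prob A * prob {\<omega>\<in>space M. X \<omega> \<in> B}"
  shows "distr (density M (indicator A)) borel X = scale_measure (emeasure M A) (distr M borel X)"
proof (rule measure_eqI)
  fix B :: "real set" assume "B \<in> sets (distr (density M (indicator A)) borel X)"
  then have [measurable]: "B \<in> sets borel" by simp
  note A [measurable]
  have "emeasure (distr (density M (indicator A)) borel X) B =
      emeasure (density M (indicator A)) {\<omega>\<in>space M. X \<omega> \<in> B}"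
    by (subst emeasure_distr) (auto simp: vimage_def Int_def conj_commute)
  also have "\<dots> = emeasure M (A \<inter> {\<omega>\<in>space M. X \<omega> \<in> B})"
    by (subst emeasure_density) (auto simp flip: indicator_inter_arith)
  also have "\<dots> = emeasure M A * emeasure M {\<omega>\<in>space M. X \<omega> \<in> B}"
    by (simp add: emeasure_eq_measure indep flip: ennreal_mult)
  also have "\<dots> = emeasure (scale_measure (emeasure M A) (distr M borel X)) B"
    by (simp add: emeasure_distr vimage_def Int_def conj_commute)
  finally show "emeasure (distr (density M (indicator A)) borel X) B =
      emeasure (scale_measure (emeasure M A) (distr M borel X)) B" .
qed simp

lemma (in prob_space) nn_integral_indicator_indep:
  fixes X :: "'a \<Rightarrow> real"
  assumes A: "A \<in> events" and X [measurable]: "X \<in> borel_measurable M"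
    and indep: "\<And>B. B \<in> sets borel \<Longrightarrow>
      prob (A \<inter> {\<omega>\<in>space M. X \<omega> \<in> B}) = prob A * prob {\<omega>\<in>space M. X \<omega> \<in> B}"
    and f [measurable]: "f \<in> borel_measurable borel"
  shows "(\<integral>\<^sup>+\<omega>. indicator A \<omega> * f (X \<omega>) \<partial>M) = emeasure M A * (\<integral>\<^sup>+\<omega>. f (X \<omega>) \<partial>M)"
proof -
  note A [measurable]
  have "(\<integral>\<^sup>+\<omega>. indicator A \<omega> * f (X \<omega>) \<partial>M) = (\<integral>\<^sup>+x. f x \<partial>distr (density M (indicator A)) borel X)"
    by (simp add: nn_integral_distr nn_integral_density)
  also have "\<dots> = emeasure M A * (\<integral>\<^sup>+\<omega>. f (X \<omega>) \<partial>M)"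
    by (simp add: distr_density_indicator_indep[OF A X indep] nn_integral_scale_measure nn_integral_distr)
  finally show ?thesis .
qed

lemma (in prob_space) integral_indicator_indep:
  fixes X :: "'a \<Rightarrow> real"
  assumes A: "A \<in> events" and X: "integrable M X"
    and indep: "\<And>B. B \<in> sets borel \<Longrightarrow>
      prob (A \<inter> {\<omega>\<in>space M. X \<omega> \<in> B}) = prob A * prob {\<omega>\<in>space M. X \<omega> \<in> B}"
  shows "(\<integral>\<omega>. indicator A \<omega> * X \<omega> \<partial>M) = prob A * (\<integral>\<omega>. X \<omega> \<partial>M)"
proof -
  have [measurable]: "X \<in> borel_measurable M" using X by simp
  have split: "ennreal (c * (indicator A \<omega> * x)) = indicator A \<omega> * ennreal (c * x)" for \<omega> and c x :: real
    by (auto simp: indicator_def)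
  have nn: "(\<integral>\<^sup>+\<omega>. ennreal (c * (indicator A \<omega> * X \<omega>)) \<partial>M) = emeasure M A * (\<integral>\<^sup>+\<omega>. ennreal (c * X \<omega>) \<partial>M)"
    for c :: real
    using nn_integral_indicator_indep[OF A \<open>X \<in> borel_measurable M\<close> indep, of "\<lambda>x. ennreal (c * x)"]
    by (simp add: split)
  have "integrable M (\<lambda>\<omega>. indicator A \<omega> * X \<omega>)"
    using integrable_mult_indicator[OF A X] by simp
  then show ?thesis
    using nn[of 1] nn[of "-1"] X
    by (simp add: real_lebesgue_integral_def emeasure_eq_measure enn2real_mult right_diff_distrib)
qed

lemma (in prob_space) exists_prob_abs_le:
  assumes [measurable]: "X \<in> borel_measurable M" and "p < 1"
  shows "\<exists>b::nat. p \<le> prob {\<omega>\<in>space M. \<bar>X \<omega>\<bar> \<le> real b}"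
proof -
  have "(\<lambda>b. prob {\<omega>\<in>space M. \<bar>X \<omega>\<bar> \<le> real b}) \<longlonglongrightarrow> prob (\<Union>b. {\<omega>\<in>space M. \<bar>X \<omega>\<bar> \<le> real b})"
    by (rule finite_Lim_measure_incseq) (auto simp: incseq_def)
  also have "(\<Union>b. {\<omega>\<in>space M. \<bar>X \<omega>\<bar> \<le> real b}) = space M"
    using real_arch_simple by auto
  finally have "eventually (\<lambda>b. p < prob {\<omega>\<in>space M. \<bar>X \<omega>\<bar> \<le> real b}) sequentially"
    using \<open>p < 1\<close> by (intro order_tendstoD) (auto simp: prob_space)
  then show ?thesis by (auto simp: eventually_sequentially intro: less_imp_le)
qed

text \<open>A form of Vitali's convergence theorem. The tails are measured by the excess over R instead of the
integral over the set where R is exceeded: the excess is a continuous function of the variable, so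
Fatou's lemma passes the bound to the limit. What remains after removing the excess is the variable
clamped to \<open>{-R..R}\<close>, and bounded convergence applies to it.\<close>
lemma (in prob_space) integral_tendsto_uniform_tails:
  fixes X :: "nat \<Rightarrow> 'a \<Rightarrow> real"
  assumes [measurable]: "\<And>n. X n \<in> borel_measurable M" "Y \<in> borel_measurable M"
    and lim: "\<And>\<omega>. \<omega> \<in> space M \<Longrightarrow> (\<lambda>n. X n \<omega>) \<longlonglongrightarrow> Y \<omega>"
    and tails: "\<And>e. e > 0 \<Longrightarrow> \<exists>R\<ge>0. \<forall>n. (\<integral>\<^sup>+\<omega>. ennreal (\<bar>X n \<omega>\<bar> - R) \<partial>M) \<le> ennreal e"
  shows "integrable M Y" "(\<lambda>n. \<integral>\<omega>. X n \<omega> \<partial>M) \<longlonglongrightarrow> (\<integral>\<omega>. Y \<omega> \<partial>M)"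
proof -
  have tail_lim: "(\<integral>\<^sup>+\<omega>. ennreal (\<bar>Y \<omega>\<bar> - R) \<partial>M) \<le> ennreal e"
    if "\<And>n. (\<integral>\<^sup>+\<omega>. ennreal (\<bar>X n \<omega>\<bar> - R) \<partial>M) \<le> ennreal e" for R e
  proof -
    have "(\<integral>\<^sup>+\<omega>. ennreal (\<bar>Y \<omega>\<bar> - R) \<partial>M) = (\<integral>\<^sup>+\<omega>. liminf (\<lambda>n. ennreal (\<bar>X n \<omega>\<bar> - R)) \<partial>M)"
      by (intro nn_integral_cong lim_imp_Liminf[symmetric]) (auto intro!: tendsto_intros lim)
    also have "\<dots> \<le> liminf (\<lambda>n. \<integral>\<^sup>+\<omega>. ennreal (\<bar>X n \<omega>\<bar> - R) \<partial>M)"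
      by (rule nn_integral_liminf) simp
    also have "\<dots> \<le> ennreal e"
      using that by (auto intro!: Liminf_le always_eventually)
    finally show ?thesis .
  qed
  have int: "integrable M Z"
    if [measurable]: "Z \<in> borel_measurable M" and "(\<integral>\<^sup>+\<omega>. ennreal (\<bar>Z \<omega>\<bar> - R) \<partial>M) \<le> ennreal e" "R \<ge> 0"
    for Z :: "'a \<Rightarrow> real" and R e
  proof (rule integrableI_bounded)
    have "(\<integral>\<^sup>+\<omega>. ennreal (norm (Z \<omega>)) \<partial>M) \<le> (\<integral>\<^sup>+\<omega>. ennreal (\<bar>Z \<omega>\<bar> - R) + ennreal R \<partial>M)"
      using that(3) by (intro nn_integral_mono) (auto simp: ennreal_plus_if split: if_splits intro!: ennreal_leI)
    also have "\<dots> = (\<integral>\<^sup>+\<omega>. ennreal (\<bar>Z \<omega>\<bar> - R) \<partial>M) + ennreal R"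
      by (simp add: nn_integral_add emeasure_space_1)
    also have "\<dots> \<le> ennreal e + ennreal R"
      using that(2) by (intro add_right_mono)
    also have "\<dots> < \<infinity>" by simp
    finally show "(\<integral>\<^sup>+\<omega>. ennreal (norm (Z \<omega>)) \<partial>M) < \<infinity>" .
  qed simp
  define \<phi> where "\<phi> R x = max (- R) (min R x)" for R x :: real
  have \<phi>_meas [measurable]: "\<phi> R \<in> borel_measurable borel" for R
    unfolding \<phi>_def by measurable
  have \<phi>_diff: "\<bar>x - \<phi> R x\<bar> = max 0 (\<bar>x\<bar> - R)" if "R \<ge> 0" for x R
    using that by (auto simp: \<phi>_def)
  have trunc: "\<bar>(\<integral>\<omega>. Z \<omega> \<partial>M) - (\<integral>\<omega>. \<phi> R (Z \<omega>) \<partial>M)\<bar> \<le> e"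
    if [measurable]: "Z \<in> borel_measurable M" and le: "(\<integral>\<^sup>+\<omega>. ennreal (\<bar>Z \<omega>\<bar> - R) \<partial>M) \<le> ennreal e" and "R \<ge> 0" "e > 0"
    for Z :: "'a \<Rightarrow> real" and R e
  proof -
    have Z: "integrable M Z" using int that by blast
    have p: "integrable M (\<lambda>\<omega>. \<phi> R (Z \<omega>))"
      by (rule integrable_const_bound[where B = R]) (use that(3) in \<open>auto simp: \<phi>_def\<close>)
    have "\<bar>(\<integral>\<omega>. Z \<omega> \<partial>M) - (\<integral>\<omega>. \<phi> R (Z \<omega>) \<partial>M)\<bar> \<le> (\<integral>\<omega>. \<bar>Z \<omega> - \<phi> R (Z \<omega>)\<bar> \<partial>M)"
      using integral_abs_bound[of M "\<lambda>\<omega>. Z \<omega> - \<phi> R (Z \<omega>)"] Z p by simp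
    also have "\<dots> \<le> e"
    proof -
      have "ennreal (\<integral>\<omega>. \<bar>Z \<omega> - \<phi> R (Z \<omega>)\<bar> \<partial>M) = (\<integral>\<^sup>+\<omega>. ennreal \<bar>Z \<omega> - \<phi> R (Z \<omega>)\<bar> \<partial>M)"
        using Z p by (intro nn_integral_eq_integral[symmetric]) auto
      also have "\<dots> = (\<integral>\<^sup>+\<omega>. ennreal (\<bar>Z \<omega>\<bar> - R) \<partial>M)"
        using \<phi>_diff[OF \<open>R \<ge> 0\<close>]  by (intro nn_integral_cong) (simp add: max_def ennreal_neg)
      also have "\<dots> \<le> ennreal e" by (rule le)
      finally show ?thesis using \<open>e > 0\<close> by simp
    qed
    finally show ?thesis .
  qed
  obtain R1 where R1: "R1 \<ge> 0" "\<And>n. (\<integral>\<^sup>+\<omega>. ennreal (\<bar>X n \<omega>\<bar> - R1) \<partial>M) \<le> ennreal 1"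
    using tails[of 1] by (metis zero_less_one)
  show "integrable M Y"
    by (rule int[OF _ tail_lim[OF R1(2)] R1(1)]) simp
  show "(\<lambda>n. \<integral>\<omega>. X n \<omega> \<partial>M) \<longlonglongrightarrow> (\<integral>\<omega>. Y \<omega> \<partial>M)"
  proof (rule LIMSEQ_I)
    fix e :: real assume "e > 0"
    then obtain R where R: "R \<ge> 0" "\<And>n. (\<integral>\<^sup>+\<omega>. ennreal (\<bar>X n \<omega>\<bar> - R) \<partial>M) \<le> ennreal (e/3)"
      using tails[of "e/3"] by auto
    have "(\<lambda>n. \<integral>\<omega>. \<phi> R (X n \<omega>) \<partial>M) \<longlonglongrightarrow> (\<integral>\<omega>. \<phi> R (Y \<omega>) \<partial>M)"
    proof (rule integral_dominated_convergence[where w = "\<lambda>_. R"])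
      show "AE \<omega> in M. (\<lambda>n. \<phi> R (X n \<omega>)) \<longlonglongrightarrow> \<phi> R (Y \<omega>)"
        unfolding \<phi>_def using lim by (auto intro!: tendsto_intros)
    qed (use R in \<open>auto simp: \<phi>_def\<close>)
    then have "eventually (\<lambda>n. dist (\<integral>\<omega>. \<phi> R (X n \<omega>) \<partial>M) (\<integral>\<omega>. \<phi> R (Y \<omega>) \<partial>M) < e/3) sequentially"
      using \<open>e > 0\<close> by (intro tendstoD) auto
    then obtain N where N: "\<And>n. n \<ge> N \<Longrightarrow> \<bar>(\<integral>\<omega>. \<phi> R (X n \<omega>) \<partial>M) - (\<integral>\<omega>. \<phi> R (Y \<omega>) \<partial>M)\<bar> < e/3"
      by (auto simp: eventually_sequentially dist_real_def)
    have "norm ((\<integral>\<omega>. X n \<omega> \<partial>M) - (\<integral>\<omega>. Y \<omega> \<partial>M)) < e" if "n \<ge> N" for n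
    proof -
      have "\<bar>(\<integral>\<omega>. X n \<omega> \<partial>M) - (\<integral>\<omega>. \<phi> R (X n \<omega>) \<partial>M)\<bar> \<le> e/3"
        using R \<open>e > 0\<close> by (intro trunc) auto
      moreover have "\<bar>(\<integral>\<omega>. Y \<omega> \<partial>M) - (\<integral>\<omega>. \<phi> R (Y \<omega>) \<partial>M)\<bar> \<le> e/3"
        using R \<open>e > 0\<close> by (intro trunc tail_lim) auto
      ultimately show ?thesis using N[OF that] unfolding real_norm_def by linarith
    qed
    then show "\<exists>N. \<forall>n\<ge>N. norm ((\<integral>\<omega>. X n \<omega> \<partial>M) - (\<integral>\<omega>. Y \<omega> \<partial>M)) < e" by auto
  qed
qed

section \<open>Increments of a Levy process\<close>

context levy_process
begin

lemma space_F: "t \<in> {0..T} \<Longrightarrow> space (F t) = space M"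
  using subalgebra_F by (auto simp: subalgebra_def)

lemma sets_F_events: "t \<in> {0..T} \<Longrightarrow> A \<in> sets (F t) \<Longrightarrow> A \<in> events"
  using subalgebra_F by (auto simp: subalgebra_def)

lemma L_measurable: "t \<in> {0..T} \<Longrightarrow> L t \<in> borel_measurable M"
  using measurable_from_subalg[OF subalgebra_F adapted] .

lemma increment_measurable:
  "0 \<le> s \<Longrightarrow> s \<le> t \<Longrightarrow> t \<le> T \<Longrightarrow> (\<lambda>\<omega>. L t \<omega> - L s \<omega>) \<in> borel_measurable M"
  by (intro borel_measurable_diff L_measurable) auto

lemma prob_increment_indep:
  assumes "0 \<le> s" "s \<le> t" "t \<le> T" "A \<in> sets (F s)" "B \<in> sets borel"
  shows "prob (A \<inter> {\<omega>\<in>space M. L t \<omega> - L s \<omega> \<in> B}) = prob A * prob {\<omega>\<in>space M. L t \<omega> - L s \<omega> \<in> B}"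
proof (rule indep_setD[OF independent_increments[OF assms(1-3)] assms(4)])
  show "{\<omega>\<in>space M. L t \<omega> - L s \<omega> \<in> B} \<in> sets (vimage_algebra (space M) (\<lambda>\<omega>. L t \<omega> - L s \<omega>) borel)"
    using in_vimage_algebra[OF assms(5), of "\<lambda>\<omega>. L t \<omega> - L s \<omega>" "space M"]
    by (simp add: vimage_def Int_def conj_commute)
qed

lemma nn_integral_increment:
  fixes f :: "real \<Rightarrow> ennreal"
  assumes "0 \<le> s" "s \<le> t" "t \<le> T" and [measurable]: "f \<in> borel_measurable borel"
  shows "(\<integral>\<^sup>+\<omega>. f (L t \<omega> - L s \<omega>) \<partial>M) = (\<integral>\<^sup>+\<omega>. f (L (t - s) \<omega>) \<partial>M)"
proof -
  note [measurable] = increment_measurable[OF assms(1-3)]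
  have [measurable]: "L (t - s) \<in> borel_measurable M" using assms by (intro L_measurable) auto
  have "(\<integral>\<^sup>+\<omega>. f (L t \<omega> - L s \<omega>) \<partial>M) = (\<integral>\<^sup>+x. f x \<partial>distr M borel (\<lambda>\<omega>. L t \<omega> - L s \<omega>))"
    by (rule nn_integral_distr[symmetric]) measurable
  also have "\<dots> = (\<integral>\<^sup>+\<omega>. f (L (t - s) \<omega>) \<partial>M)"
    unfolding stationary_increments[OF assms(1-3)] by (rule nn_integral_distr) measurable
  finally show ?thesis .
qed

lemma
  assumes "0 \<le> s" "s \<le> t" "t \<le> T"
  shows integrable_increment_iff: "integrable M (\<lambda>\<omega>. L t \<omega> - L s \<omega>) \<longleftrightarrow> integrable M (L (t - s))"
    and integral_increment: "(\<integral>\<omega>. L t \<omega> - L s \<omega> \<partial>M) = (\<integral>\<omega>. L (t - s) \<omega> \<partial>M)"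
proof -
  have m: "L (t - s) \<in> borel_measurable M" using assms by (intro L_measurable) auto
  note m' = increment_measurable[OF assms] and st = stationary_increments[OF assms]
  have id: "(\<lambda>x :: real. x) \<in> borel_measurable borel" by simp
  show "integrable M (\<lambda>\<omega>. L t \<omega> - L s \<omega>) \<longleftrightarrow> integrable M (L (t - s))"
    by (rule trans[OF integrable_distr_eq[OF m' id, symmetric, unfolded st] integrable_distr_eq[OF m id]])
  show "(\<integral>\<omega>. L t \<omega> - L s \<omega> \<partial>M) = (\<integral>\<omega>. L (t - s) \<omega> \<partial>M)"
    by (rule trans[OF integral_distr[OF m' id, symmetric, unfolded st] integral_distr[OF m id]])
qed

lemma prob_abs_increment:
  assumes "0 \<le> s" "s \<le> t" "t \<le> T"
  shows "prob {\<omega>\<in>space M. \<bar>L t \<omega> - L s \<omega>\<bar> \<le> b} = prob {\<omega>\<in>space M. \<bar>L (t - s) \<omega>\<bar> \<le> b}"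
proof -
  let ?B = "{x :: real. \<bar>x\<bar> \<le> b}"
  have B: "?B \<in> sets borel" by measurable
  have m: "L (t - s) \<in> borel_measurable M" using assms by (intro L_measurable) auto
  have "measure (distr M borel (\<lambda>\<omega>. L t \<omega> - L s \<omega>)) ?B = measure (distr M borel (L (t - s))) ?B"
    unfolding stationary_increments[OF assms] ..
  then show ?thesis
    unfolding measure_distr[OF increment_measurable[OF assms] B] measure_distr[OF m B]
    by (simp add: vimage_def Int_def conj_commute)
qed

text \<open>Right-continuity for sequences that may attain the limit point, as grid approximations of a stopping
time do.\<close>
lemma right_continuous_path:
  assumes "\<omega> \<in> space M" "t \<in> {0..<T}" "x \<longlonglongrightarrow> t" "\<And>n. t \<le> x n"
  shows "(\<lambda>n. L (x n) \<omega>) \<longlonglongrightarrow> L t \<omega>"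
proof -
  have "{t..} - {t} = {t<..} - {t}" by auto
  then have "at t within {t..} = at_right t" unfolding at_within_def by (rule arg_cong)
  then have "continuous (at t within {t..}) (\<lambda>t. L t \<omega>)"
    using cadlag_paths[OF assms(1)] assms(2) by (auto simp: cadlag_on_def)
  then show ?thesis
    using assms(3,4) unfolding continuous_within_sequentially by (auto simp: o_def)
qed

text \<open>Right-continuity of the paths at 0 makes \<open>L u\<close> tend to 0 pointwise, hence in probability.\<close>
lemma prob_abs_le_one_near_time_zero:
  assumes "p < 1"
  shows "\<exists>\<delta>>0. \<delta> \<le> T \<and> (\<forall>u. 0 \<le> u \<longrightarrow> u \<le> \<delta> \<longrightarrow> p \<le> prob {\<omega>\<in>space M. \<bar>L u \<omega>\<bar> \<le> 1})"
proof (rule ccontr)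
  assume neg: "\<not> ?thesis"
  have "\<exists>u. 0 \<le> u \<and> u \<le> T / Suc n \<and> prob {\<omega>\<in>space M. \<bar>L u \<omega>\<bar> \<le> 1} < p" for n
  proof -
    have "0 < T / Suc n" "T / Suc n \<le> T" using horizon_pos by (auto simp: field_simps)
    then show ?thesis using neg by (meson not_le)
  qed
  then obtain u where u: "\<And>n. 0 \<le> u n" "\<And>n. u n \<le> T / Suc n"
    "\<And>n. prob {\<omega>\<in>space M. \<bar>L (u n) \<omega>\<bar> \<le> 1} < p" by metis
  have uT: "u n \<in> {0..T}" for n
  proof -
    have "T / Suc n \<le> T" using horizon_pos by (simp add: field_simps)
    then show ?thesis using u(1,2)[of n] by auto
  qed
  have [measurable]: "L (u n) \<in> borel_measurable M" for n using uT by (rule L_measurable)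
  have "(\<lambda>n. T / Suc n) \<longlonglongrightarrow> 0" using LIMSEQ_Suc[OF lim_const_over_n[of T]] by simp
  then have "u \<longlonglongrightarrow> 0"
    by (rule tendsto_sandwich[of "\<lambda>_. 0" u sequentially, rotated 3]) (use u in auto)
  have lim: "(\<lambda>n. L (u n) \<omega>) \<longlonglongrightarrow> 0" if "\<omega> \<in> space M" for \<omega>
    using right_continuous_path[OF that _ \<open>u \<longlonglongrightarrow> 0\<close> u(1)] start_zero[OF that] horizon_pos by auto
  have "(\<lambda>n. \<integral>\<omega>. indicator {\<omega>\<in>space M. \<bar>L (u n) \<omega>\<bar> \<le> 1} \<omega> \<partial>M) \<longlonglongrightarrow> (\<integral>\<omega>. 1 \<partial>M :: real)"
  proof (rule integral_dominated_convergence[where w = "\<lambda>_. 1"])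
    have "(\<lambda>n. indicat_real {\<omega>\<in>space M. \<bar>L (u n) \<omega>\<bar> \<le> 1} \<omega>) \<longlonglongrightarrow> 1" if "\<omega> \<in> space M" for \<omega>
    proof (rule tendsto_eventually)
      have "eventually (\<lambda>n. dist (L (u n) \<omega>) 0 < 1) sequentially"
        using lim[OF that] by (rule tendstoD) simp
      then show "eventually (\<lambda>n. indicat_real {\<omega>\<in>space M. \<bar>L (u n) \<omega>\<bar> \<le> 1} \<omega> = 1) sequentially"
        by eventually_elim (use that in auto)
    qed
    then show "AE \<omega> in M. (\<lambda>n. indicat_real {\<omega>\<in>space M. \<bar>L (u n) \<omega>\<bar> \<le> 1} \<omega>) \<longlonglongrightarrow> 1" by auto
  qed auto
  then have "(\<lambda>n. prob {\<omega>\<in>space M. \<bar>L (u n) \<omega>\<bar> \<le> 1}) \<longlonglongrightarrow> 1" by (simp add: prob_space)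
  then have "1 \<le> p"
    by (rule LIMSEQ_le_const2) (use u(3) less_imp_le in blast)
  with assms show False by simp
qed

text \<open>A time u is a multiple of a small step plus a rest shorter than the step. The finitely many multiples
have a common bound, and the increment over the rest has the law of L at a time near 0.\<close>
lemma tight_on_horizon:
  "\<exists>b\<ge>0. \<forall>u\<in>{0..T}. 1/2 \<le> prob {\<omega>\<in>space M. \<bar>L u \<omega>\<bar> \<le> b}"
proof -
  obtain \<delta> where \<delta>: "\<delta> > 0" "\<delta> \<le> T"
    "\<And>u. 0 \<le> u \<Longrightarrow> u \<le> \<delta> \<Longrightarrow> 3/4 \<le> prob {\<omega>\<in>space M. \<bar>L u \<omega>\<bar> \<le> 1}"
    using prob_abs_le_one_near_time_zero[of "3/4"] by auto
  have "\<exists>b::nat. k * \<delta> \<le> T \<longrightarrow> 3/4 \<le> prob {\<omega>\<in>space M. \<bar>L (k * \<delta>) \<omega>\<bar> \<le> b}" for k :: nat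
  proof (cases "k * \<delta> \<le> T")
    case True
    then have "L (k * \<delta>) \<in> borel_measurable M" using \<delta> by (intro L_measurable) auto
    from exists_prob_abs_le[OF this, of "3/4"] show ?thesis by auto
  qed auto
  then obtain b :: "nat \<Rightarrow> nat" where
    b: "\<And>k. k * \<delta> \<le> T \<Longrightarrow> 3/4 \<le> prob {\<omega>\<in>space M. \<bar>L (k * \<delta>) \<omega>\<bar> \<le> b k}" by metis
  define N where "N = nat \<lfloor>T / \<delta>\<rfloor>"
  define B where "B = Max (b ` {..N}) + 1"
  have "1/2 \<le> prob {\<omega>\<in>space M. \<bar>L u \<omega>\<bar> \<le> B}" if u: "u \<in> {0..T}" for u
  proof -
    define k where "k = nat \<lfloor>u / \<delta>\<rfloor>"
    have k1: "k * \<delta> \<le> u" using u \<delta>(1) by (simp add: k_def pos_le_divide_eq[symmetric])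
    have k2: "u - k * \<delta> \<le> \<delta>"
    proof -
      have "u / \<delta> \<le> k + 1" using u \<delta>(1) by (simp add: k_def) linarith
      then show ?thesis using \<delta>(1) by (simp add: field_simps)
    qed
    have "k \<le> N" unfolding k_def N_def using u \<delta>(1)
      by (intro nat_mono floor_mono divide_right_mono) auto
    then have "b k + 1 \<le> B" unfolding B_def by (auto intro!: Max_ge)
    have k0: "0 \<le> k * \<delta>" "k * \<delta> \<le> T" using k1 u \<delta>(1) by auto
    let ?A = "{\<omega>\<in>space M. \<bar>L (k * \<delta>) \<omega>\<bar> \<le> b k}" and ?B = "{\<omega>\<in>space M. \<bar>L u \<omega> - L (k * \<delta>) \<omega>\<bar> \<le> 1}"
    have [measurable]: "L u \<in> borel_measurable M" "L (k * \<delta>) \<in> borel_measurable M"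
      using u k0 by (auto intro!: L_measurable)
    have "3/4 \<le> prob ?A" using b k0 by auto
    moreover have "3/4 \<le> prob ?B"
      using \<delta>(3)[of "u - k * \<delta>"] k1 k2 prob_abs_increment[of "k * \<delta>" u 1] u k0 by auto
    \<comment> \<open>Two events of probability at least 3/4 meet with probability at least 1/2.\<close>
    moreover have "prob ?A + prob ?B \<le> 1 + prob (?A \<inter> ?B)"
      using finite_measure_Union'[of ?A "?B"] prob_le_1[of "?A \<union> ?B"]
        finite_measure_Diff'[of ?B ?A] by (simp add: Int_commute)
    moreover have "prob (?A \<inter> ?B) \<le> prob {\<omega>\<in>space M. \<bar>L u \<omega>\<bar> \<le> B}"
      using \<open>b k + 1 \<le> B\<close> by (intro finite_measure_mono) auto
    ultimately show ?thesis by linarith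
  qed
  then show ?thesis by (intro exI[of _ "real B"]) auto
qed

text \<open>Symmetrisation: with probability at least one half the increment from u to T is at most b in absolute
value, and it is independent of \<open>L u\<close>. On that event \<open>L T\<close> is within b of \<open>L u\<close>, so moments at
time u are controlled by moments at time T at the price of a factor 2 and a shift by b. The bound
holds for infinite integrals too, which matters because it is used to prove integrability.\<close>
lemma nn_integral_le_terminal:
  fixes f g :: "real \<Rightarrow> ennreal"
  assumes b: "\<And>u. u \<in> {0..T} \<Longrightarrow> 1/2 \<le> prob {\<omega>\<in>space M. \<bar>L u \<omega>\<bar> \<le> b}"
    and [measurable]: "f \<in> borel_measurable borel" "g \<in> borel_measurable borel"
    and le: "\<And>x y. \<bar>y\<bar> \<le> b \<Longrightarrow> g x \<le> f (x + y)"
    and u: "u \<in> {0..T}"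
  shows "(\<integral>\<^sup>+\<omega>. g (L u \<omega>) \<partial>M) \<le> 2 * (\<integral>\<^sup>+\<omega>. f (L T \<omega>) \<partial>M)"
proof -
  let ?A = "{\<omega>\<in>space M. \<bar>L T \<omega> - L u \<omega>\<bar> \<le> b}"
  have [measurable]: "L u \<in> borel_measurable M" "L T \<in> borel_measurable M"
    using u by (auto intro!: L_measurable)
  have A: "?A \<in> events" by measurable
  have "prob (?A \<inter> {\<omega>\<in>space M. L u \<omega> \<in> B}) = prob ?A * prob {\<omega>\<in>space M. L u \<omega> \<in> B}"
    if "B \<in> sets borel" for B
  proof -
    have "{\<omega>\<in>space M. L u \<omega> \<in> B} \<in> sets (F u)"
      using measurable_sets[OF adapted[OF u] that] space_F[OF u] by (simp add: vimage_def Int_def conj_commute)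
    from prob_increment_indep[OF _ _ _ this, of T "{x. \<bar>x\<bar> \<le> b}"] u
    show ?thesis by (simp add: Int_commute mult.commute)
  qed
  note indep = nn_integral_indicator_indep[OF A \<open>L u \<in> borel_measurable M\<close> this \<open>g \<in> borel_measurable borel\<close>]
  have "1/2 \<le> prob ?A" using b[of "T - u"] prob_abs_increment[of u T b] u by auto
  then have half: "ennreal (1/2) \<le> emeasure M ?A" unfolding emeasure_eq_measure by (rule ennreal_leI)
  have "2 * ennreal (1/2) = 1"
    using ennreal_mult[of 2 "1/2", symmetric] by (simp only: ennreal_numeral) simp
  then have "(\<integral>\<^sup>+\<omega>. g (L u \<omega>) \<partial>M) = 2 * (ennreal (1/2) * (\<integral>\<^sup>+\<omega>. g (L u \<omega>) \<partial>M))"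
    by (simp only: mult.assoc[symmetric] mult_1)
  also have "\<dots> \<le> 2 * (emeasure M ?A * (\<integral>\<^sup>+\<omega>. g (L u \<omega>) \<partial>M))"
    by (intro mult_left_mono mult_right_mono half) auto
  also have "emeasure M ?A * (\<integral>\<^sup>+\<omega>. g (L u \<omega>) \<partial>M) = (\<integral>\<^sup>+\<omega>. indicator ?A \<omega> * g (L u \<omega>) \<partial>M)"
    by (rule indep[symmetric])
  also have "\<dots> \<le> (\<integral>\<^sup>+\<omega>. f (L T \<omega>) \<partial>M)"
  proof (rule nn_integral_mono)
    fix \<omega> show "indicator ?A \<omega> * g (L u \<omega>) \<le> f (L T \<omega>)"
      using le[of "L T \<omega> - L u \<omega>" "L u \<omega>"] by (auto simp: indicator_def)
  qed
  finally show ?thesis by (simp add: mult_left_mono)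
qed

end

section \<open>Stopping times approximated on a time grid\<close>

text \<open>Rounding upwards keeps a stopping time a stopping time and approaches it from the right, the side on
which the paths are continuous.\<close>
definition grid_time :: "real \<Rightarrow> nat \<Rightarrow> real \<Rightarrow> real" where
  "grid_time T n t = T * real_of_int \<lceil>t * real n / T\<rceil> / real n"

lemma grid_time_bounds:
  assumes "0 < T" "0 < n" "t \<in> {0..T}"
  shows "t \<le> grid_time T n t" "grid_time T n t \<le> T" "grid_time T n t - t \<le> T / n" "0 \<le> grid_time T n t"
proof -
  let ?c = "\<lceil>t * real n / T\<rceil>"
  have 1: "t * n / T \<le> ?c" "?c \<le> t * n / T + 1" by linarith+
  have "t * n / T \<le> n" using assms by (simp add: pos_divide_le_eq mult.commute mult_right_mono)
  then have 2: "?c \<le> int n" by (simp add: ceiling_le_iff)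
  have "t = T * (t * n / T) / n" using assms by simp
  also have "\<dots> \<le> grid_time T n t"
    unfolding grid_time_def using 1 assms by (intro divide_right_mono mult_left_mono) auto
  finally show t: "t \<le> grid_time T n t" .
  then show "0 \<le> grid_time T n t" using assms by auto
  have "grid_time T n t \<le> T * real n / n"
    unfolding grid_time_def using 2 assms by (intro divide_right_mono mult_left_mono) auto
  then show "grid_time T n t \<le> T" using assms by simp
  have "grid_time T n t \<le> T * (t * n / T + 1) / n"
    unfolding grid_time_def using 1 assms by (intro divide_right_mono mult_left_mono) auto
  also have "\<dots> = t + T / n" using assms by (simp add: field_simps)
  finally show "grid_time T n t - t \<le> T / n" by simp
qed

lemma grid_time_LIMSEQ:
  assumes "0 < T" "t \<in> {0..T}"
  shows "(\<lambda>n. grid_time T (Suc n) t) \<longlonglongrightarrow> t"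
proof (rule tendsto_sandwich[OF _ _ tendsto_const])
  have "(\<lambda>n. T / Suc n) \<longlonglongrightarrow> 0" using LIMSEQ_Suc[OF lim_const_over_n[of T]] by simp
  from tendsto_add[OF tendsto_const[of t] this] show "(\<lambda>n. t + T / Suc n) \<longlonglongrightarrow> t" by simp
  show "\<forall>\<^sub>F n in sequentially. t \<le> grid_time T (Suc n) t"
    using grid_time_bounds(1)[OF assms(1) _ assms(2)] by simp
  show "\<forall>\<^sub>F n in sequentially. grid_time T (Suc n) t \<le> t + T / Suc n"
  proof (intro always_eventually allI)
    fix n show "grid_time T (Suc n) t \<le> t + T / Suc n"
      using grid_time_bounds(3)[OF assms(1) zero_less_Suc assms(2), of n] by linarith
  qed
qed

context levy_process
begin

definition grid_cell :: "('a \<Rightarrow> real) \<Rightarrow> nat \<Rightarrow> nat \<Rightarrow> 'a set" where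
  "grid_cell \<tau> n i = {\<omega>\<in>space M. \<lceil>\<tau> \<omega> * real n / T\<rceil> = int i}"

lemma stopping_time_range: "stopping_time_on F T \<tau> \<Longrightarrow> \<tau> \<omega> \<in> {0..T}"
  unfolding stopping_time_on_def by (meson rangeI subsetD)

lemma stopping_time_event:
  assumes "stopping_time_on F T \<tau>" "t \<in> {0..T}"
  shows "{\<omega>\<in>space M. \<tau> \<omega> \<le> t} \<in> sets (F t)"
proof -
  have "Measurable.pred (F t) (\<lambda>\<omega>. \<tau> \<omega> \<le> t)"
    using assms(1) unfolding stopping_time_on_def stopping_time_def by blast
  from predE[OF this] show ?thesis unfolding space_F[OF assms(2)] .
qed

lemma stopping_time_borel_measurable:
  assumes \<tau>: "stopping_time_on F T \<tau>"
  shows "\<tau> \<in> borel_measurable M"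
  unfolding borel_measurable_iff_le
proof
  fix a :: real
  consider "a < 0" | "a \<in> {0..T}" | "T < a" by fastforce
  then show "{\<omega>\<in>space M. \<tau> \<omega> \<le> a} \<in> events"
  proof cases
    case 1
    then have "\<not> \<tau> \<omega> \<le> a" for \<omega> using stopping_time_range[OF \<tau>, of \<omega>] by simp
    then show ?thesis by simp
  next
    case 2
    then show ?thesis using sets_F_events stopping_time_event[OF \<tau>] by blast
  next
    case 3
    then have "\<tau> \<omega> \<le> a" for \<omega> using stopping_time_range[OF \<tau>, of \<omega>] by simp
    then show ?thesis by simp
  qed
qed

lemma grid_point: "i \<le> n \<Longrightarrow> 0 < n \<Longrightarrow> T * real i / real n \<in> {0..T}"
  using horizon_pos by (simp add: pos_divide_le_eq)

lemma le_grid_point_iff: "0 < n \<Longrightarrow> \<tau> \<le> T * real k / real n \<longleftrightarrow> \<tau> * real n / T \<le> real k"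
  using horizon_pos by (simp add: pos_divide_le_eq pos_le_divide_eq mult.commute)

text \<open>The cell is the event that \<open>\<tau>\<close> falls into the half-open interval that ends at the grid point. It is
known at the grid point because rounding is upwards, and so it is independent of the
increment from there to T.\<close>
lemma grid_cell_adapted:
  assumes \<tau>: "stopping_time_on F T \<tau>" and n: "0 < n" and i: "i \<le> n"
  shows "grid_cell \<tau> n i \<in> sets (F (T * i / n))"
proof (cases i)
  case 0
  have "grid_cell \<tau> n i = {\<omega>\<in>space M. \<tau> \<omega> \<le> 0}"
    unfolding grid_cell_def 0
  proof (intro Collect_cong conj_cong refl)
    fix \<omega>
    have "0 \<le> \<tau> \<omega> * n / T" using stopping_time_range[OF \<tau>, of \<omega>] horizon_pos by simp
    moreover have "\<tau> \<omega> * n / T \<le> 0 \<longleftrightarrow> \<tau> \<omega> \<le> 0" using le_grid_point_iff[OF n, of "\<tau> \<omega>" 0] by simp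
    ultimately show "\<lceil>\<tau> \<omega> * real n / T\<rceil> = int 0 \<longleftrightarrow> \<tau> \<omega> \<le> 0" by (simp add: ceiling_eq_iff)
  qed
  then show ?thesis using stopping_time_event[OF \<tau>, of 0] horizon_pos 0 by simp
next
  case (Suc j)
  let ?t = "T * i / n" and ?s = "T * j / n"
  have t: "?t \<in> {0..T}" "?s \<in> {0..T}" using i Suc by (intro grid_point n; simp)+
  have st: "?s \<le> ?t" using Suc horizon_pos n by (intro divide_right_mono mult_left_mono) auto
  have "grid_cell \<tau> n i = {\<omega>\<in>space M. \<tau> \<omega> \<le> ?t} - {\<omega>\<in>space M. \<tau> \<omega> \<le> ?s}"
    unfolding grid_cell_def le_grid_point_iff[OF n] by (auto simp: ceiling_eq_iff Suc)
  moreover have "{\<omega>\<in>space M. \<tau> \<omega> \<le> ?s} \<in> sets (F ?t)"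
    using F_mono[of ?s ?t] stopping_time_event[OF \<tau> t(2)] t st by auto
  ultimately show ?thesis using stopping_time_event[OF \<tau> t(1)] by auto
qed

lemma grid_cell_event:
  "stopping_time_on F T \<tau> \<Longrightarrow> 0 < n \<Longrightarrow> i \<le> n \<Longrightarrow> grid_cell \<tau> n i \<in> events"
  using sets_F_events[OF grid_point grid_cell_adapted] by blast

lemma grid_time_on_cell: "\<omega> \<in> grid_cell \<tau> n i \<Longrightarrow> grid_time T n (\<tau> \<omega>) = T * i / n"
  by (simp add: grid_cell_def grid_time_def)

lemma grid_cell_exhaust:
  assumes "stopping_time_on F T \<tau>" "0 < n" "\<omega> \<in> space M"
  obtains i where "i \<le> n" "\<omega> \<in> grid_cell \<tau> n i"
proof
  let ?i = "nat \<lceil>\<tau> \<omega> * n / T\<rceil>"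
  have "0 \<le> \<tau> \<omega> * n / T" "\<tau> \<omega> * n / T \<le> n"
    using stopping_time_range[OF assms(1), of \<omega>] horizon_pos le_grid_point_iff[OF assms(2), of "\<tau> \<omega>" n] assms(2)
    by auto
  then show "?i \<le> n" "\<omega> \<in> grid_cell \<tau> n ?i"
    using assms(3) by (auto simp: grid_cell_def ceiling_le_iff nat_le_iff)
qed

lemma grid_cell_disjoint: "i \<noteq> j \<Longrightarrow> grid_cell \<tau> n i \<inter> grid_cell \<tau> n j = {}"
  by (auto simp: grid_cell_def)

lemma sum_over_grid_cells:
  fixes h :: "nat \<Rightarrow> 'b :: semiring_1"
  assumes "\<omega> \<in> grid_cell \<tau> n i" "i \<le> n"
  shows "(\<Sum>j\<le>n. indicator (grid_cell \<tau> n j) \<omega> * h j) = h i"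
proof -
  have "(\<Sum>j\<le>n. indicator (grid_cell \<tau> n j) \<omega> * h j) = (\<Sum>j\<le>n. if j = i then h j else 0)"
    using assms(1) grid_cell_disjoint[of _ i \<tau> n] by (intro sum.cong) (auto simp: indicator_def)
  also have "\<dots> = h i" using assms(2) by simp
  finally show ?thesis .
qed

text \<open>increment after the grid approximation\<close>
definition after_grid :: "('a \<Rightarrow> real) \<Rightarrow> nat \<Rightarrow> 'a \<Rightarrow> real" where
  "after_grid \<tau> n \<omega> = L T \<omega> - L (grid_time T n (\<tau> \<omega>)) \<omega>"

lemma after_grid_eq_sum:
  fixes h :: "real \<Rightarrow> 'b :: semiring_1"
  assumes "stopping_time_on F T \<tau>" "0 < n" "\<omega> \<in> space M"
  shows "h (after_grid \<tau> n \<omega>) = (\<Sum>i\<le>n. indicator (grid_cell \<tau> n i) \<omega> * h (L T \<omega> - L (T * i / n) \<omega>))"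
proof -
  obtain i where i: "i \<le> n" "\<omega> \<in> grid_cell \<tau> n i" using grid_cell_exhaust[OF assms] .
  show ?thesis
    unfolding sum_over_grid_cells[OF i(2,1)] after_grid_def grid_time_on_cell[OF i(2)] ..
qed

lemma after_grid_measurable:
  assumes \<tau>: "stopping_time_on F T \<tau>" and n: "0 < n"
  shows "after_grid \<tau> n \<in> borel_measurable M"
proof -
  have "(\<lambda>\<omega>. \<Sum>i\<le>n. indicator (grid_cell \<tau> n i) \<omega> * (L T \<omega> - L (T * i / n) \<omega>)) \<in> borel_measurable M"
    using grid_cell_event[OF \<tau> n] grid_point[OF _ n] horizon_pos
    by (intro borel_measurable_sum borel_measurable_times borel_measurable_indicator increment_measurable) auto
  then show ?thesis
    by (rule measurable_cong[THEN iffD1, rotated]) (rule after_grid_eq_sum[OF \<tau> n, symmetric, where h = "\<lambda>x. x"])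
qed

lemma after_grid_LIMSEQ:
  assumes \<tau>: "stopping_time_on F T \<tau>" and \<omega>: "\<omega> \<in> space M"
  shows "(\<lambda>n. after_grid \<tau> (Suc n) \<omega>) \<longlonglongrightarrow> L T \<omega> - L (\<tau> \<omega>) \<omega>"
proof (cases "\<tau> \<omega> = T")
  case True
  then have "grid_time T (Suc n) (\<tau> \<omega>) = T" for n
    using grid_time_bounds(1,2)[of T "Suc n" T] horizon_pos by (intro antisym) auto
  then show ?thesis using True by (simp add: after_grid_def)
next
  case False
  then have t: "\<tau> \<omega> \<in> {0..<T}" using stopping_time_range[OF \<tau>, of \<omega>] by auto
  show ?thesis unfolding after_grid_def
    using grid_time_LIMSEQ[OF horizon_pos stopping_time_range[OF \<tau>]]
      grid_time_bounds(1)[OF horizon_pos _ stopping_time_range[OF \<tau>]]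
    by (intro tendsto_diff tendsto_const right_continuous_path[OF \<omega> t]) auto
qed

text \<open>On each cell the increment is the one after a deterministic time, independent of the cell and with
the law of L at the remaining time.\<close>
lemma nn_integral_after_grid:
  fixes f :: "real \<Rightarrow> ennreal"
  assumes \<tau>: "stopping_time_on F T \<tau>" and n: "0 < n" and f [measurable]: "f \<in> borel_measurable borel"
  shows "(\<integral>\<^sup>+\<omega>. f (after_grid \<tau> n \<omega>) \<partial>M) =
    (\<Sum>i\<le>n. emeasure M (grid_cell \<tau> n i) * (\<integral>\<^sup>+\<omega>. f (L (T - T * i / n) \<omega>) \<partial>M))"
proof -
  have m: "(\<lambda>\<omega>. L T \<omega> - L (T * i / n) \<omega>) \<in> borel_measurable M" if "i \<le> n" for i
    using grid_point[OF that n] by (intro increment_measurable) auto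
  have "(\<integral>\<^sup>+\<omega>. f (after_grid \<tau> n \<omega>) \<partial>M) =
      (\<integral>\<^sup>+\<omega>. (\<Sum>i\<le>n. indicator (grid_cell \<tau> n i) \<omega> * f (L T \<omega> - L (T * i / n) \<omega>)) \<partial>M)"
    by (intro nn_integral_cong after_grid_eq_sum[OF \<tau> n])
  also have "\<dots> = (\<Sum>i\<le>n. \<integral>\<^sup>+\<omega>. indicator (grid_cell \<tau> n i) \<omega> * f (L T \<omega> - L (T * i / n) \<omega>) \<partial>M)"
  proof (rule nn_integral_sum)
    fix i assume "i \<in> {..n}"
    then have "i \<le> n" by simp
    note [measurable] = m[OF this] grid_cell_event[OF \<tau> n this]
    show "(\<lambda>\<omega>. indicator (grid_cell \<tau> n i) \<omega> * f (L T \<omega> - L (T * i / n) \<omega>)) \<in> borel_measurable M"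
      by measurable
  qed
  also have "\<dots> = (\<Sum>i\<le>n. emeasure M (grid_cell \<tau> n i) * (\<integral>\<^sup>+\<omega>. f (L (T - T * i / n) \<omega>) \<partial>M))"
  proof (rule sum.cong[OF refl])
    fix i assume "i \<in> {..n}"
    then have i: "i \<le> n" by simp
    note t = grid_point[OF i n]
    have "(\<integral>\<^sup>+\<omega>. indicator (grid_cell \<tau> n i) \<omega> * f (L T \<omega> - L (T * i / n) \<omega>) \<partial>M) =
        emeasure M (grid_cell \<tau> n i) * (\<integral>\<^sup>+\<omega>. f (L T \<omega> - L (T * i / n) \<omega>) \<partial>M)"
      using t by (intro nn_integral_indicator_indep grid_cell_event[OF \<tau> n i] m[OF i] f
          prob_increment_indep grid_cell_adapted[OF \<tau> n i]) auto
    also have "(\<integral>\<^sup>+\<omega>. f (L T \<omega> - L (T * i / n) \<omega>) \<partial>M) = (\<integral>\<^sup>+\<omega>. f (L (T - T * i / n) \<omega>) \<partial>M)"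
      using t by (intro nn_integral_increment f) auto
    finally show "(\<integral>\<^sup>+\<omega>. indicator (grid_cell \<tau> n i) \<omega> * f (L T \<omega> - L (T * i / n) \<omega>) \<partial>M) =
        emeasure M (grid_cell \<tau> n i) * (\<integral>\<^sup>+\<omega>. f (L (T - T * i / n) \<omega>) \<partial>M)" .
  qed
  finally show ?thesis .
qed

end

section \<open>Wald's identity\<close>

lemma (in prob_space) martingale_on_mean:
  assumes mart: "martingale_on M F T X" and "0 \<le> T" and sub: "subalgebra M (F 0)"
  shows "integrable M (X T)" "(\<integral>\<omega>. X T \<omega> \<partial>M) = (\<integral>\<omega>. X 0 \<omega> \<partial>M)"
proof -
  interpret F0: sigma_finite_subalgebra M "F 0"
    using finite_measure_subalgebra_is_sigma_finite[of M "F 0"] sub finite_measure_axioms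
    by (simp add: finite_measure_subalgebra_def finite_measure_subalgebra_axioms_def)
  have 0: "0 \<in> {0..T}" "T \<in> {0..T}" using \<open>0 \<le> T\<close> by auto
  show int: "integrable M (X T)" using mart 0 unfolding martingale_on_def by blast
  have int0: "integrable M (X 0)" and ce: "AE \<omega> in M. real_cond_exp M (F 0) (X T) \<omega> = X 0 \<omega>"
    using mart 0 unfolding martingale_on_def by blast+
  have "(\<integral>\<omega>. X T \<omega> \<partial>M) = (\<integral>\<omega>. real_cond_exp M (F 0) (X T) \<omega> \<partial>M)"
    by (rule F0.real_cond_exp_int(2)[OF int, symmetric])
  also have "\<dots> = (\<integral>\<omega>. X 0 \<omega> \<partial>M)"
    using ce int0 by (intro integral_cong_AE) auto
  finally show "(\<integral>\<omega>. X T \<omega> \<partial>M) = (\<integral>\<omega>. X 0 \<omega> \<partial>M)" .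
qed

context levy_process
begin

lemma sum_emeasure_grid_cells:
  assumes "stopping_time_on F T \<tau>" "0 < n" "I \<subseteq> {..n}"
  shows "(\<Sum>i\<in>I. emeasure M (grid_cell \<tau> n i) * c) = emeasure M (\<Union>i\<in>I. grid_cell \<tau> n i) * c"
proof -
  have "(\<Sum>i\<in>I. emeasure M (grid_cell \<tau> n i)) = emeasure M (\<Union>i\<in>I. grid_cell \<tau> n i)"
    using assms grid_cell_event[OF assms(1,2)] grid_cell_disjoint finite_subset[OF assms(3)]
    by (intro sum_emeasure) (auto simp: disjoint_family_on_def)
  then show ?thesis by (simp only: sum_distrib_right[symmetric])
qed

text \<open>The remainder is 0 on \<open>\<tau> = T\<close>. On the grid, the event \<open>\<tau> < T\<close> contributes its probability
times truncated moments of L at times in \<open>{0..T}\<close>, which symmetrisation compares with that of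
\<open>L T\<close>; Fatou's lemma removes the grid.\<close>
lemma truncated_remainder_bound:
  assumes \<tau>: "stopping_time_on F T \<tau>" and "0 \<le> R" "0 \<le> b"
    and b: "\<And>u. u \<in> {0..T} \<Longrightarrow> 1/2 \<le> prob {\<omega>\<in>space M. \<bar>L u \<omega>\<bar> \<le> b}"
  shows "(\<integral>\<^sup>+\<omega>. ennreal (min R \<bar>L T \<omega> - L (\<tau> \<omega>) \<omega>\<bar>) \<partial>M) \<le>
    emeasure M {\<omega>\<in>space M. \<tau> \<omega> < T} * (2 * (\<integral>\<^sup>+\<omega>. ennreal (min R \<bar>L T \<omega>\<bar>) \<partial>M) + ennreal b)"
    (is "_ \<le> ?p * ?S")
proof -
  have S: "(\<integral>\<^sup>+\<omega>. ennreal (min R \<bar>L u \<omega>\<bar>) \<partial>M) \<le> ?S" if u: "u \<in> {0..T}" for u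
  proof -
    note [measurable] = L_measurable[OF u]
    have "(\<integral>\<^sup>+\<omega>. ennreal (min R \<bar>L u \<omega>\<bar>) \<partial>M) \<le> (\<integral>\<^sup>+\<omega>. ennreal (min R \<bar>L u \<omega>\<bar> - b) + ennreal b \<partial>M)"
      using \<open>0 \<le> b\<close> by (intro nn_integral_mono) (auto simp: ennreal_plus_if intro!: ennreal_leI)
    also have "\<dots> = (\<integral>\<^sup>+\<omega>. ennreal (min R \<bar>L u \<omega>\<bar> - b) \<partial>M) + ennreal b"
      by (subst nn_integral_add) (auto simp: emeasure_space_1)
    also have "\<dots> \<le> ?S"
      by (intro add_right_mono nn_integral_le_terminal[OF b _ _ _ u]) (auto intro!: ennreal_leI)
    finally show ?thesis .
  qed
  have approx: "(\<integral>\<^sup>+\<omega>. ennreal (min R \<bar>after_grid \<tau> (Suc n) \<omega>\<bar>) \<partial>M) \<le> ?p * ?S" for n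
  proof -
    let ?N = "Suc n" and ?f = "\<lambda>x::real. ennreal (min R \<bar>x\<bar>)"
    have last: "(\<integral>\<^sup>+\<omega>. ?f (L (T - T * ?N / ?N) \<omega>) \<partial>M) = 0"
      using start_zero \<open>0 \<le> R\<close> by (intro nn_integral_zero' AE_I2) simp
    have "(\<integral>\<^sup>+\<omega>. ?f (after_grid \<tau> ?N \<omega>) \<partial>M) =
        (\<Sum>i\<le>?N. emeasure M (grid_cell \<tau> ?N i) * (\<integral>\<^sup>+\<omega>. ?f (L (T - T * i / ?N) \<omega>) \<partial>M))"
      by (rule nn_integral_after_grid[OF \<tau>]) auto
    \<comment> \<open>The last cell contributes nothing; on all other cells \<open>\<tau> < T\<close>.\<close>
    also have "\<dots> = (\<Sum>i\<le>n. emeasure M (grid_cell \<tau> ?N i) * (\<integral>\<^sup>+\<omega>. ?f (L (T - T * i / ?N) \<omega>) \<partial>M))"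
      using last by (simp only: sum.atMost_Suc mult_zero_right add_0_right)
    also have "\<dots> \<le> (\<Sum>i\<le>n. emeasure M (grid_cell \<tau> ?N i) * ?S)"
    proof (intro sum_mono mult_left_mono S)
      fix i assume "i \<in> {..n}"
      then show "T - T * i / ?N \<in> {0..T}" using grid_point[of i ?N] by simp
    qed simp
    also have "\<dots> = emeasure M (\<Union>i\<le>n. grid_cell \<tau> ?N i) * ?S"
      by (rule sum_emeasure_grid_cells[OF \<tau>]) auto
    also have "\<dots> \<le> ?p * ?S"
    proof (intro mult_right_mono emeasure_mono)
      have "\<tau> \<omega> < T" if "i \<le> n" "\<omega> \<in> grid_cell \<tau> ?N i" for i \<omega>
      proof -
        have "T * real i < T * real ?N" using that(1) horizon_pos by (intro mult_strict_left_mono) auto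
        then have "T * i / ?N < T" by (simp add: pos_divide_less_eq del: of_nat_Suc)
        moreover have "\<tau> \<omega> \<le> T * i / ?N"
          using grid_time_bounds(1)[OF horizon_pos _ stopping_time_range[OF \<tau>], of ?N \<omega>]
          unfolding grid_time_on_cell[OF that(2)] by simp
        ultimately show ?thesis by linarith
      qed
      then show "(\<Union>i\<le>n. grid_cell \<tau> ?N i) \<subseteq> {\<omega>\<in>space M. \<tau> \<omega> < T}" by (auto simp: grid_cell_def)
      note [measurable] = stopping_time_borel_measurable[OF \<tau>]
      show "{\<omega>\<in>space M. \<tau> \<omega> < T} \<in> events" by measurable
    qed simp
    finally show ?thesis .
  qed
  have "(\<integral>\<^sup>+\<omega>. ennreal (min R \<bar>L T \<omega> - L (\<tau> \<omega>) \<omega>\<bar>) \<partial>M) =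
      (\<integral>\<^sup>+\<omega>. liminf (\<lambda>n. ennreal (min R \<bar>after_grid \<tau> (Suc n) \<omega>\<bar>)) \<partial>M)"
    by (intro nn_integral_cong lim_imp_Liminf[symmetric])
      (auto intro!: tendsto_intros after_grid_LIMSEQ[OF \<tau>])
  also have "\<dots> \<le> liminf (\<lambda>n. \<integral>\<^sup>+\<omega>. ennreal (min R \<bar>after_grid \<tau> (Suc n) \<omega>\<bar>) \<partial>M)"
  proof (rule nn_integral_liminf)
    fix n note [measurable] = after_grid_measurable[OF \<tau>, of "Suc n", simplified]
    show "(\<lambda>\<omega>. ennreal (min R \<bar>after_grid \<tau> (Suc n) \<omega>\<bar>)) \<in> borel_measurable M" by measurable
  qed
  also have "\<dots> \<le> ?p * ?S"
    using approx by (auto intro!: Liminf_le always_eventually)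
  finally show ?thesis .
qed

text \<open>For r the truncated first absolute moment of \<open>L T\<close> and C that of \<open>L \<tau>\<close> (without truncation), the remainder bound
gives \<open>r \<le> C + (2 r + b) / 4\<close>. The factor of r on the right is one half, so r is bounded
uniformly in the truncation level. Truncation is what makes r finite, so that it can be subtracted.\<close>
lemma integrable_terminal_of_stopped:
  assumes \<tau>: "stopping_time_on F T \<tau>" and p: "prob {\<omega>\<in>space M. \<tau> \<omega> < T} \<le> 1/4"
    and int: "integrable M (\<lambda>\<omega>. L (\<tau> \<omega>) \<omega>)"
  shows "integrable M (L T)"
proof -
  obtain b where b: "0 \<le> b" "\<And>u. u \<in> {0..T} \<Longrightarrow> 1/2 \<le> prob {\<omega>\<in>space M. \<bar>L u \<omega>\<bar> \<le> b}"
    using tight_on_horizon by blast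
  have LT [measurable]: "L T \<in> borel_measurable M" using horizon_pos by (intro L_measurable) auto
  note [measurable] = borel_measurable_integrable[OF int]
  define C where "C = (\<integral>\<omega>. \<bar>L (\<tau> \<omega>) \<omega>\<bar> \<partial>M)"
  have bound: "(\<integral>\<^sup>+\<omega>. ennreal (min (real R) \<bar>L T \<omega>\<bar>) \<partial>M) \<le> ennreal (2 * C + b / 2)" for R :: nat
  proof -
    define r where "r = (\<integral>\<omega>. min (real R) \<bar>L T \<omega>\<bar> \<partial>M)"
    have "integrable M (\<lambda>\<omega>. min (real R) \<bar>L T \<omega>\<bar>)"
      by (rule integrable_const_bound[where B = R]) auto
    then have r: "(\<integral>\<^sup>+\<omega>. ennreal (min (real R) \<bar>L T \<omega>\<bar>) \<partial>M) = ennreal r" and "0 \<le> r"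
      unfolding r_def by (auto intro!: nn_integral_eq_integral integral_nonneg_AE)
    have C: "(\<integral>\<^sup>+\<omega>. ennreal \<bar>L (\<tau> \<omega>) \<omega>\<bar> \<partial>M) = ennreal C" and "0 \<le> C"
      unfolding C_def using int by (auto intro!: nn_integral_eq_integral integral_nonneg_AE)
    have "ennreal r \<le> (\<integral>\<^sup>+\<omega>. ennreal \<bar>L (\<tau> \<omega>) \<omega>\<bar> + ennreal (min (real R) \<bar>L T \<omega> - L (\<tau> \<omega>) \<omega>\<bar>) \<partial>M)"
      unfolding r[symmetric] by (intro nn_integral_mono) (auto simp flip: ennreal_plus intro!: ennreal_leI)
    also have "\<dots> = ennreal C + (\<integral>\<^sup>+\<omega>. ennreal (min (real R) \<bar>L T \<omega> - L (\<tau> \<omega>) \<omega>\<bar>) \<partial>M)"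
      by (subst nn_integral_add) (auto simp: C)
    also have "\<dots> \<le> ennreal C + emeasure M {\<omega>\<in>space M. \<tau> \<omega> < T} * (2 * ennreal r + ennreal b)"
      unfolding r[symmetric] using b by (intro add_left_mono truncated_remainder_bound[OF \<tau>]) auto
    also have "\<dots> \<le> ennreal C + ennreal (1/4) * (2 * ennreal r + ennreal b)"
      using p unfolding emeasure_eq_measure by (intro add_left_mono mult_right_mono ennreal_leI) auto
    also have "\<dots> = ennreal (C + 1/4 * (2 * r + b))"
    proof -
      have "2 * ennreal r = ennreal (2 * r)" by (simp add: ennreal_mult')
      then show ?thesis using \<open>0 \<le> r\<close> \<open>0 \<le> b\<close> \<open>0 \<le> C\<close>
        by (simp only: ennreal_plus[symmetric] ennreal_mult[symmetric] mult_nonneg_nonneg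
            add_nonneg_nonneg zero_le_numeral zero_le_divide_1_iff)
    qed
    finally have "r \<le> C + 1/4 * (2 * r + b)"
      using \<open>0 \<le> r\<close> \<open>0 \<le> b\<close> \<open>0 \<le> C\<close> by (subst (asm) ennreal_le_iff) auto
    then show ?thesis unfolding r by (intro ennreal_leI) (simp add: field_simps)
  qed
  show ?thesis
  proof (rule integrableI_bounded[OF LT])
    have "(\<integral>\<^sup>+\<omega>. ennreal (norm (L T \<omega>)) \<partial>M) =
        (\<integral>\<^sup>+\<omega>. liminf (\<lambda>R. ennreal (min (real R) \<bar>L T \<omega>\<bar>)) \<partial>M)"
    proof (intro nn_integral_cong lim_imp_Liminf[symmetric])
      fix \<omega>
      have "eventually (\<lambda>R. \<bar>L T \<omega>\<bar> \<le> real R) sequentially"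
        using filterlim_real_sequentially by (simp add: filterlim_at_top)
      then have "eventually (\<lambda>R. ennreal (min (real R) \<bar>L T \<omega>\<bar>) = ennreal (norm (L T \<omega>))) sequentially"
        by eventually_elim (simp add: min_def)
      then show "(\<lambda>R. ennreal (min (real R) \<bar>L T \<omega>\<bar>)) \<longlonglongrightarrow> ennreal (norm (L T \<omega>))"
        by (rule tendsto_eventually)
    qed simp
    also have "\<dots> \<le> liminf (\<lambda>R. \<integral>\<^sup>+\<omega>. ennreal (min (real R) \<bar>L T \<omega>\<bar>) \<partial>M)"
      by (rule nn_integral_liminf) measurable
    also have "\<dots> \<le> ennreal (2 * C + b / 2)"
      using bound by (auto intro!: Liminf_le always_eventually)
    finally show "(\<integral>\<^sup>+\<omega>. ennreal (norm (L T \<omega>)) \<partial>M) < \<infinity>"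
      by (rule le_less_trans) simp
  qed
qed

text \<open>Symmetrisation with the excess over a level shows that the tails at all times are dominated by the
tail of the single integrable variable \<open>L T\<close>.\<close>
lemma uniform_tails:
  assumes int: "integrable M (L T)" and "e > 0"
  shows "\<exists>R\<ge>0. \<forall>u\<in>{0..T}. (\<integral>\<^sup>+\<omega>. ennreal (\<bar>L u \<omega>\<bar> - R) \<partial>M) \<le> ennreal e"
proof -
  obtain b where b: "0 \<le> b" "\<And>u. u \<in> {0..T} \<Longrightarrow> 1/2 \<le> prob {\<omega>\<in>space M. \<bar>L u \<omega>\<bar> \<le> b}"
    using tight_on_horizon by blast
  note [measurable] = borel_measurable_integrable[OF int]
  have "(\<lambda>k. \<integral>\<^sup>+\<omega>. ennreal (\<bar>L T \<omega>\<bar> - real k) \<partial>M) \<longlonglongrightarrow> (\<integral>\<^sup>+\<omega>. 0 \<partial>M)"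
  proof (rule nn_integral_dominated_convergence[where w = "\<lambda>\<omega>. ennreal \<bar>L T \<omega>\<bar>"])
    show "(\<integral>\<^sup>+\<omega>. ennreal \<bar>L T \<omega>\<bar> \<partial>M) < \<infinity>"
      using int by (simp add: integrable_iff_bounded)
    show "AE \<omega> in M. (\<lambda>k. ennreal (\<bar>L T \<omega>\<bar> - real k)) \<longlonglongrightarrow> 0"
    proof (rule AE_I2)
      fix \<omega>
      have "eventually (\<lambda>k. \<bar>L T \<omega>\<bar> \<le> real k) sequentially"
        using filterlim_real_sequentially by (simp add: filterlim_at_top)
      then have "eventually (\<lambda>k. ennreal (\<bar>L T \<omega>\<bar> - real k) = 0) sequentially"
        by eventually_elim (simp add: ennreal_neg)
      then show "(\<lambda>k. ennreal (\<bar>L T \<omega>\<bar> - real k)) \<longlonglongrightarrow> 0"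
        by (rule tendsto_eventually)
    qed
  qed (auto intro!: ennreal_leI)
  then have "(\<lambda>k. \<integral>\<^sup>+\<omega>. ennreal (\<bar>L T \<omega>\<bar> - real k) \<partial>M) \<longlonglongrightarrow> 0" by simp
  moreover have "0 < ennreal (e/2)" using \<open>e > 0\<close> by simp
  ultimately have "eventually (\<lambda>k. (\<integral>\<^sup>+\<omega>. ennreal (\<bar>L T \<omega>\<bar> - real k) \<partial>M) < ennreal (e/2)) sequentially"
    by (rule order_tendstoD(2))
  then obtain k :: nat where k: "(\<integral>\<^sup>+\<omega>. ennreal (\<bar>L T \<omega>\<bar> - real k) \<partial>M) < ennreal (e/2)"
    by (auto simp: eventually_sequentially)
  have "(\<integral>\<^sup>+\<omega>. ennreal (\<bar>L u \<omega>\<bar> - (b + k)) \<partial>M) \<le> ennreal e" if u: "u \<in> {0..T}" for u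
  proof -
    have "(\<integral>\<^sup>+\<omega>. ennreal (\<bar>L u \<omega>\<bar> - (b + k)) \<partial>M) \<le> 2 * (\<integral>\<^sup>+\<omega>. ennreal (\<bar>L T \<omega>\<bar> - k) \<partial>M)"
      by (rule nn_integral_le_terminal[OF b(2) _ _ _ u]) (auto intro!: ennreal_leI)
    also have "\<dots> \<le> 2 * ennreal (e/2)" using k by (intro mult_left_mono) auto
    also have "\<dots> = ennreal e" using \<open>e > 0\<close> ennreal_mult[of 2 "e/2"] by simp
    finally show ?thesis .
  qed
  with b(1) show ?thesis by (intro exI[of _ "b + real k"]) auto
qed

lemma integrable_at_time:
  assumes int: "integrable M (L T)" and u: "u \<in> {0..T}"
  shows "integrable M (L u)"
proof (rule integrableI_bounded[OF L_measurable[OF u]])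
  note [measurable] = L_measurable[OF u]
  obtain R where "0 \<le> R" and R: "(\<integral>\<^sup>+\<omega>. ennreal (\<bar>L u \<omega>\<bar> - R) \<partial>M) \<le> ennreal 1"
    using uniform_tails[OF int zero_less_one] u by blast
  have "(\<integral>\<^sup>+\<omega>. ennreal (norm (L u \<omega>)) \<partial>M) \<le> (\<integral>\<^sup>+\<omega>. ennreal (\<bar>L u \<omega>\<bar> - R) + ennreal R \<partial>M)"
    using \<open>0 \<le> R\<close> by (intro nn_integral_mono) (simp add: ennreal_plus_if ennreal_leI)
  also have "\<dots> = (\<integral>\<^sup>+\<omega>. ennreal (\<bar>L u \<omega>\<bar> - R) \<partial>M) + ennreal R"
    by (subst nn_integral_add) (auto simp: emeasure_space_1)
  also have "\<dots> \<le> ennreal 1 + ennreal R" by (rule add_right_mono[OF R])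
  also have "\<dots> < \<infinity>" by simp
  finally show "(\<integral>\<^sup>+\<omega>. ennreal (norm (L u \<omega>)) \<partial>M) < \<infinity>" .
qed

lemma mean_at_grid_point:
  assumes int: "integrable M (L T)" and "k \<le> n" "0 < n"
  shows "(\<integral>\<omega>. L (T * real k / real n) \<omega> \<partial>M) = real k / real n * (\<integral>\<omega>. L T \<omega> \<partial>M)"
proof -
  let ?h = "T * real 1 / real n"
  have mult: "(\<integral>\<omega>. L (T * real j / real n) \<omega> \<partial>M) = real j * (\<integral>\<omega>. L ?h \<omega> \<partial>M)" if "j \<le> n" for j
    using that
  proof (induction j)
    case 0
    have "(\<integral>\<omega>. L 0 \<omega> \<partial>M) = (\<integral>\<omega>. 0 \<partial>M)" by (intro Bochner_Integration.integral_cong refl start_zero)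
    then show ?case by simp
  next
    case (Suc j)
    let ?s = "T * real j / real n" and ?t = "T * real (Suc j) / real n"
    have st: "?s \<in> {0..T}" "?t \<in> {0..T}" using Suc.prems \<open>0 < n\<close> by (intro grid_point; simp)+
    have diff: "?t - ?s = ?h" by (simp add: diff_divide_distrib[symmetric] algebra_simps)
    have le: "?s \<le> ?t" using horizon_pos by (intro divide_right_mono mult_left_mono) auto
    have "(\<integral>\<omega>. L ?t \<omega> \<partial>M) - (\<integral>\<omega>. L ?s \<omega> \<partial>M) = (\<integral>\<omega>. L ?h \<omega> \<partial>M)"
      using integral_increment[of ?s ?t] st le integrable_at_time[OF int] unfolding diff by simp
    then show ?case using Suc.IH Suc.prems by (simp add: algebra_simps)
  qed
  have "(\<integral>\<omega>. L T \<omega> \<partial>M) = real n * (\<integral>\<omega>. L ?h \<omega> \<partial>M)" using mult[of n] \<open>0 < n\<close> by simp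
  then show ?thesis using mult[OF \<open>k \<le> n\<close>] \<open>0 < n\<close> by simp
qed

text \<open>Wald's identity on the grid: only the means at rational multiples of T enter, and additivity over
increments determines those.\<close>
lemma integral_after_grid:
  assumes int: "integrable M (L T)" and \<tau>: "stopping_time_on F T \<tau>" and n: "0 < n"
  shows "(\<integral>\<omega>. after_grid \<tau> n \<omega> \<partial>M) = (\<integral>\<omega>. 1 - grid_time T n (\<tau> \<omega>) / T \<partial>M) * (\<integral>\<omega>. L T \<omega> \<partial>M)"
proof -
  let ?m = "\<integral>\<omega>. L T \<omega> \<partial>M"
  have D: "integrable M (\<lambda>\<omega>. L T \<omega> - L (T * i / n) \<omega>)" if "i \<le> n" for i
    using int integrable_at_time[OF int grid_point[OF that n]] by simp
  have cell: "integrable M (\<lambda>\<omega>. indicat_real (grid_cell \<tau> n i) \<omega> * X \<omega>)"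
    if "i \<le> n" "integrable M X" for i X
    using integrable_mult_indicator[OF grid_cell_event[OF \<tau> n that(1)] that(2)] by simp
  have "(\<integral>\<omega>. after_grid \<tau> n \<omega> \<partial>M) =
      (\<integral>\<omega>. (\<Sum>i\<le>n. indicator (grid_cell \<tau> n i) \<omega> * (L T \<omega> - L (T * i / n) \<omega>)) \<partial>M)"
    by (intro Bochner_Integration.integral_cong refl after_grid_eq_sum[OF \<tau> n, where h = "\<lambda>x. x"])
  also have "\<dots> = (\<Sum>i\<le>n. \<integral>\<omega>. indicator (grid_cell \<tau> n i) \<omega> * (L T \<omega> - L (T * i / n) \<omega>) \<partial>M)"
    by (intro Bochner_Integration.integral_sum cell D) auto
  also have "\<dots> = (\<Sum>i\<le>n. prob (grid_cell \<tau> n i) * ((1 - i / n) * ?m))"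
  proof (rule sum.cong[OF refl])
    fix i assume "i \<in> {..n}"
    then have i: "i \<le> n" by simp
    note t = grid_point[OF i n]
    have "(\<integral>\<omega>. indicator (grid_cell \<tau> n i) \<omega> * (L T \<omega> - L (T * i / n) \<omega>) \<partial>M) =
        prob (grid_cell \<tau> n i) * (\<integral>\<omega>. L T \<omega> - L (T * i / n) \<omega> \<partial>M)"
      using t by (intro integral_indicator_indep grid_cell_event[OF \<tau> n i] D[OF i]
          prob_increment_indep grid_cell_adapted[OF \<tau> n i]) auto
    also have "(\<integral>\<omega>. L T \<omega> - L (T * i / n) \<omega> \<partial>M) = (1 - i / n) * ?m"
      using int integrable_at_time[OF int t] mean_at_grid_point[OF int i n] by (simp add: algebra_simps)
    finally show "(\<integral>\<omega>. indicator (grid_cell \<tau> n i) \<omega> * (L T \<omega> - L (T * i / n) \<omega>) \<partial>M) =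
        prob (grid_cell \<tau> n i) * ((1 - i / n) * ?m)" .
  qed
  also have "\<dots> = (\<Sum>i\<le>n. \<integral>\<omega>. indicator (grid_cell \<tau> n i) \<omega> * (1 - i / n) \<partial>M) * ?m"
    using grid_cell_event[OF \<tau> n] unfolding sum_distrib_right by (intro sum.cong) auto
  also have "(\<Sum>i\<le>n. \<integral>\<omega>. indicator (grid_cell \<tau> n i) \<omega> * (1 - i / n) \<partial>M) =
      (\<integral>\<omega>. (\<Sum>i\<le>n. indicator (grid_cell \<tau> n i) \<omega> * (1 - i / n)) \<partial>M)"
    by (intro Bochner_Integration.integral_sum[symmetric] cell) auto
  also have "\<dots> = (\<integral>\<omega>. 1 - grid_time T n (\<tau> \<omega>) / T \<partial>M)"
  proof (intro Bochner_Integration.integral_cong refl)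
    fix \<omega> assume "\<omega> \<in> space M"
    then obtain i where i: "i \<le> n" "\<omega> \<in> grid_cell \<tau> n i" using grid_cell_exhaust[OF \<tau> n] by metis
    show "(\<Sum>i\<le>n. indicator (grid_cell \<tau> n i) \<omega> * (1 - real i / real n)) = 1 - grid_time T n (\<tau> \<omega>) / T"
      unfolding sum_over_grid_cells[OF i(2,1)] grid_time_on_cell[OF i(2)] using horizon_pos by simp
  qed
  finally show ?thesis .
qed

text \<open>The grid increments converge pointwise by right-continuity. Their tails are averages over the cells
of tails of L at deterministic times, so they are uniformly small and the expectations converge.\<close>
lemma
  assumes int: "integrable M (L T)" and \<tau>: "stopping_time_on F T \<tau>"
  shows integrable_at_stopping_time: "integrable M (\<lambda>\<omega>. L (\<tau> \<omega>) \<omega>)"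
    and wald_identity: "(\<integral>\<omega>. L (\<tau> \<omega>) \<omega> \<partial>M) = (\<integral>\<omega>. \<tau> \<omega> \<partial>M) / T * (\<integral>\<omega>. L T \<omega> \<partial>M)"
proof -
  let ?m = "\<integral>\<omega>. L T \<omega> \<partial>M" and ?Y = "\<lambda>\<omega>. L T \<omega> - L (\<tau> \<omega>) \<omega>"
  have meas: "after_grid \<tau> (Suc n) \<in> borel_measurable M" for n by (rule after_grid_measurable[OF \<tau>]) simp
  have Y: "?Y \<in> borel_measurable M"
    by (rule borel_measurable_LIMSEQ_real[OF after_grid_LIMSEQ[OF \<tau>] meas])
  have tails: "\<exists>R\<ge>0. \<forall>n. (\<integral>\<^sup>+\<omega>. ennreal (\<bar>after_grid \<tau> (Suc n) \<omega>\<bar> - R) \<partial>M) \<le> ennreal e" if e: "e > 0" for e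
  proof -
    obtain R where "0 \<le> R" and R: "\<And>u. u \<in> {0..T} \<Longrightarrow> (\<integral>\<^sup>+\<omega>. ennreal (\<bar>L u \<omega>\<bar> - R) \<partial>M) \<le> ennreal e"
      using uniform_tails[OF int e] by blast
    have "(\<integral>\<^sup>+\<omega>. ennreal (\<bar>after_grid \<tau> (Suc n) \<omega>\<bar> - R) \<partial>M) \<le> ennreal e" for n
    proof -
      let ?N = "Suc n"
      have "(\<integral>\<^sup>+\<omega>. ennreal (\<bar>after_grid \<tau> ?N \<omega>\<bar> - R) \<partial>M) =
          (\<Sum>i\<le>?N. emeasure M (grid_cell \<tau> ?N i) * (\<integral>\<^sup>+\<omega>. ennreal (\<bar>L (T - T * i / ?N) \<omega>\<bar> - R) \<partial>M))"
        by (rule nn_integral_after_grid[OF \<tau>, where f = "\<lambda>x. ennreal (\<bar>x\<bar> - R)"]) auto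
      also have "\<dots> \<le> (\<Sum>i\<le>?N. emeasure M (grid_cell \<tau> ?N i) * ennreal e)"
      proof (intro sum_mono mult_left_mono R)
        fix i assume "i \<in> {..?N}"
        then show "T - T * i / ?N \<in> {0..T}" using grid_point[of i ?N] by simp
      qed simp
      also have "\<dots> = emeasure M (\<Union>i\<le>?N. grid_cell \<tau> ?N i) * ennreal e"
        by (rule sum_emeasure_grid_cells[OF \<tau>]) auto
      also have "\<dots> \<le> 1 * ennreal e"
        by (intro mult_right_mono emeasure_le_1 zero_le)
      finally show ?thesis by simp
    qed
    with \<open>0 \<le> R\<close> show ?thesis by blast
  qed
  have Y_int: "integrable M ?Y"
    and lim1: "(\<lambda>n. \<integral>\<omega>. after_grid \<tau> (Suc n) \<omega> \<partial>M) \<longlonglongrightarrow> (\<integral>\<omega>. ?Y \<omega> \<partial>M)"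
    using integral_tendsto_uniform_tails[OF meas Y after_grid_LIMSEQ[OF \<tau>] tails] by blast+
  show L\<tau>: "integrable M (\<lambda>\<omega>. L (\<tau> \<omega>) \<omega>)"
    using Bochner_Integration.integrable_diff[OF int Y_int] by simp
  note [measurable] = stopping_time_borel_measurable[OF \<tau>]
  have "(\<lambda>n. \<integral>\<omega>. 1 - grid_time T (Suc n) (\<tau> \<omega>) / T \<partial>M) \<longlonglongrightarrow> (\<integral>\<omega>. 1 - \<tau> \<omega> / T \<partial>M)"
  proof (rule integral_dominated_convergence[where w = "\<lambda>_. 1"])
    show "AE \<omega> in M. (\<lambda>n. 1 - grid_time T (Suc n) (\<tau> \<omega>) / T) \<longlonglongrightarrow> 1 - \<tau> \<omega> / T"
      using horizon_pos by (intro AE_I2 tendsto_intros grid_time_LIMSEQ stopping_time_range[OF \<tau>]) auto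
    show "AE \<omega> in M. norm (1 - grid_time T (Suc n) (\<tau> \<omega>) / T) \<le> 1" for n
      using grid_time_bounds(2,4)[OF horizon_pos _ stopping_time_range[OF \<tau>], of "Suc n"] horizon_pos
      by (intro AE_I2) (simp add: abs_le_iff field_simps)
    show "(\<lambda>\<omega>. 1 - grid_time T (Suc n) (\<tau> \<omega>) / T) \<in> borel_measurable M" for n
      unfolding grid_time_def by measurable
  qed auto
  then have lim2: "(\<lambda>n. (\<integral>\<omega>. 1 - grid_time T (Suc n) (\<tau> \<omega>) / T \<partial>M) * ?m) \<longlonglongrightarrow> (\<integral>\<omega>. 1 - \<tau> \<omega> / T \<partial>M) * ?m"
    by (intro tendsto_mult tendsto_const)
  have "(\<integral>\<omega>. ?Y \<omega> \<partial>M) = (\<integral>\<omega>. 1 - \<tau> \<omega> / T \<partial>M) * ?m"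
    using lim1 unfolding integral_after_grid[OF int \<tau> zero_less_Suc] by (rule LIMSEQ_unique[OF _ lim2])
  moreover have "(\<integral>\<omega>. ?Y \<omega> \<partial>M) = ?m - (\<integral>\<omega>. L (\<tau> \<omega>) \<omega> \<partial>M)" using int L\<tau> by simp
  moreover have "(\<integral>\<omega>. 1 - \<tau> \<omega> / T \<partial>M) = 1 - (\<integral>\<omega>. \<tau> \<omega> \<partial>M) / T"
  proof -
    have "integrable M \<tau>"
      by (rule integrable_const_bound[where B = T])
        (use stopping_time_range[OF \<tau>] in \<open>auto simp: abs_le_iff intro: order_trans\<close>)
    then show ?thesis by (simp add: prob_space)
  qed
  ultimately show "(\<integral>\<omega>. L (\<tau> \<omega>) \<omega> \<partial>M) = (\<integral>\<omega>. \<tau> \<omega> \<partial>M) / T * ?m" by (simp add: algebra_simps)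
qed

text \<open>Wald's identity for a constant time gives linearity of the mean at irrational multiples of T as well.\<close>
lemma mean_at_time:
  assumes int: "integrable M (L T)" and t: "t \<in> {0..T}"
  shows "(\<integral>\<omega>. L t \<omega> \<partial>M) = t / T * (\<integral>\<omega>. L T \<omega> \<partial>M)"
proof -
  have "stopping_time_on F T (\<lambda>_. t)"
    using t by (auto simp: stopping_time_on_def stopping_time_def)
  from wald_identity[OF int this] show ?thesis by (simp add: prob_space)
qed

lemma terminal_mean_zero_of_stopped:
  assumes \<tau>: "stopping_time_on F T \<tau>" and p: "prob {\<omega>\<in>space M. \<tau> \<omega> < T} \<le> 1/4"
    and int: "integrable M (\<lambda>\<omega>. L (\<tau> \<omega>) \<omega>)" and zero: "(\<integral>\<omega>. L (\<tau> \<omega>) \<omega> \<partial>M) = 0"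
  shows "integrable M (L T)" "(\<integral>\<omega>. L T \<omega> \<partial>M) = 0"
proof -
  show LT: "integrable M (L T)" by (rule integrable_terminal_of_stopped[OF \<tau> p int])
  note [measurable] = stopping_time_borel_measurable[OF \<tau>]
  have \<tau>_int: "integrable M \<tau>"
    by (rule integrable_const_bound[where B = T])
      (use stopping_time_range[OF \<tau>] in \<open>auto simp: abs_le_iff intro: order_trans\<close>)
  have "(\<integral>\<omega>. \<tau> \<omega> \<partial>M) \<noteq> 0"
  proof
    assume "(\<integral>\<omega>. \<tau> \<omega> \<partial>M) = 0"
    then have "AE \<omega> in M. \<tau> \<omega> = 0"
      using integral_nonneg_eq_0_iff_AE[OF \<tau>_int] stopping_time_range[OF \<tau>] by auto
    then have "AE \<omega> in M. \<tau> \<omega> < T" by eventually_elim (use horizon_pos in simp)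
    then have "prob {\<omega>\<in>space M. \<tau> \<omega> < T} = 1" by (subst prob_Collect_eq_1) auto
    with p show False by simp
  qed
  then show "(\<integral>\<omega>. L T \<omega> \<partial>M) = 0" using wald_identity[OF LT \<tau>] zero horizon_pos by simp
qed

lemma martingale_iff_terminal_mean_zero:
  "martingale_on M F T L \<longleftrightarrow> integrable M (L T) \<and> (\<integral>\<omega>. L T \<omega> \<partial>M) = 0"
proof
  assume mart: "martingale_on M F T L"
  have T: "0 \<le> T" "0 \<in> {0..T}" using horizon_pos by auto
  have "(\<integral>\<omega>. L 0 \<omega> \<partial>M) = (\<integral>\<omega>. 0 \<partial>M)" by (intro Bochner_Integration.integral_cong refl start_zero)
  with martingale_on_mean[OF mart T(1) subalgebra_F[OF T(2)]]
  show "integrable M (L T) \<and> (\<integral>\<omega>. L T \<omega> \<partial>M) = 0" by simp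
next
  assume "integrable M (L T) \<and> (\<integral>\<omega>. L T \<omega> \<partial>M) = 0"
  then have int: "integrable M (L T)" and zero: "(\<integral>\<omega>. L T \<omega> \<partial>M) = 0" by auto
  have I: "integrable M (L t)" and E: "(\<integral>\<omega>. L t \<omega> \<partial>M) = 0" if "t \<in> {0..T}" for t
    using integrable_at_time[OF int that] mean_at_time[OF int that] zero by auto
  have "AE \<omega> in M. real_cond_exp M (F s) (L t) \<omega> = L s \<omega>" if s: "s \<in> {0..T}" and t: "t \<in> {s..T}" for s t
  proof -
    interpret Fs: sigma_finite_subalgebra M "F s"
      using finite_measure_subalgebra_is_sigma_finite[of M "F s"] subalgebra_F[OF s] finite_measure_axioms
      by (simp add: finite_measure_subalgebra_def finite_measure_subalgebra_axioms_def)
    have t0: "t \<in> {0..T}" using s t by auto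
    show ?thesis
    proof (rule Fs.real_cond_exp_charact[OF _ I[OF t0] I[OF s] adapted[OF s]])
      fix A assume A: "A \<in> sets (F s)"
      have ev: "A \<in> events" using sets_F_events[OF s A] .
      have "(\<integral>\<omega>. indicator A \<omega> * (L t \<omega> - L s \<omega>) \<partial>M) = prob A * (\<integral>\<omega>. L t \<omega> - L s \<omega> \<partial>M)"
        using s t A I[OF t0] I[OF s] by (intro integral_indicator_indep ev prob_increment_indep) auto
      also have "\<dots> = 0" using I[OF t0] I[OF s] E[OF t0] E[OF s] by simp
      finally show "set_lebesgue_integral M A (L t) = set_lebesgue_integral M A (L s)"
        using integrable_mult_indicator[OF ev I[OF t0]] integrable_mult_indicator[OF ev I[OF s]]
        by (simp add: set_lebesgue_integral_def right_diff_distrib)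
    qed
  qed
  then show "martingale_on M F T L" using I adapted by (auto simp: martingale_on_def)
qed

end

section \<open>Relative entropy\<close>

lemma x_ln_x_ge: "0 \<le> x \<Longrightarrow> x - 1 \<le> x * ln x" for x :: real
proof (cases "x = 0")
  case False
  assume "0 \<le> x"
  with False have "0 < x" by simp
  then have "ln (1 / x) \<le> 1 / x - 1" by (intro ln_le_minus_one) simp
  then have "x * (- ln x) \<le> x * (1 / x - 1)"
    using \<open>0 < x\<close> by (intro mult_left_mono) (auto simp: ln_div)
  then show ?thesis using \<open>0 < x\<close> by (simp add: algebra_simps)
qed simp

lemma x_ln_x_eq: "0 \<le> x \<Longrightarrow> x * ln x = x - 1 \<Longrightarrow> x = 1" for x :: real
proof (cases "x = 0")
  case False
  assume "0 \<le> x" and eq: "x * ln x = x - 1"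
  with False have "0 < x" by simp
  then have "ln (1 / x) = 1 / x - 1" using eq by (simp add: ln_div field_simps)
  then have "1 / x = 1" using \<open>0 < x\<close> by (intro ln_eq_minus_one) auto
  then show ?thesis by simp
qed simp

text \<open>Integrability makes the positive and the negative part of \<open>Z ln Z\<close> finite, so their difference is
the integral.\<close>
lemma (in prob_space) relative_entropy_density:
  assumes [measurable]: "Z \<in> borel_measurable M" and Z: "\<And>\<omega>. 0 \<le> Z \<omega>"
    and int: "integrable M (\<lambda>\<omega>. Z \<omega> * ln (Z \<omega>))"
  shows "relative_entropy (density M (\<lambda>\<omega>. ennreal (Z \<omega>))) M = ereal (\<integral>\<omega>. Z \<omega> * ln (Z \<omega>) \<partial>M)"
proof -
  let ?Q = "density M (\<lambda>\<omega>. ennreal (Z \<omega>))" and ?R = "\<lambda>\<omega>. enn2real (RN_deriv M (density M (\<lambda>\<omega>. ennreal (Z \<omega>))) \<omega>)"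
  have "AE \<omega> in M. ennreal (Z \<omega>) = RN_deriv M ?Q \<omega>"
    by (rule RN_deriv_unique) auto
  then have R: "AE \<omega> in M. ?R \<omega> = Z \<omega>"
    by eventually_elim (metis Z enn2real_ennreal)
  have ac: "absolutely_continuous M ?Q" by (rule absolutely_continuousI_density) simp
  have pos: "(\<integral>\<^sup>+\<omega>. ennreal (?R \<omega> * ln (?R \<omega>)) \<partial>M) = (\<integral>\<^sup>+\<omega>. ennreal (Z \<omega> * ln (Z \<omega>)) \<partial>M)"
    by (rule nn_integral_cong_AE) (use R in eventually_elim, simp)
  have neg: "(\<integral>\<^sup>+\<omega>. ennreal (- (?R \<omega> * ln (?R \<omega>))) \<partial>M) = (\<integral>\<^sup>+\<omega>. ennreal (- (Z \<omega> * ln (Z \<omega>))) \<partial>M)"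
    by (rule nn_integral_cong_AE) (use R in eventually_elim, simp)
  have fin: "(\<integral>\<^sup>+\<omega>. ennreal (Z \<omega> * ln (Z \<omega>)) \<partial>M) \<noteq> \<infinity>" "(\<integral>\<^sup>+\<omega>. ennreal (- (Z \<omega> * ln (Z \<omega>))) \<partial>M) \<noteq> \<infinity>"
    using int by (auto simp: real_integrable_def)
  have conv: "enn2ereal x = ereal (enn2real x)" if "x \<noteq> \<infinity>" for x
    using that by (cases x) (auto simp: enn2ereal_ennreal)
  show ?thesis
    unfolding relative_entropy_def Let_def pos neg real_lebesgue_integral_def[OF int]
    using ac by (simp add: conv[OF fin(1)] conv[OF fin(2)])
qed

lemma (in prob_space) relative_entropy_self: "relative_entropy M M = 0"
  using relative_entropy_density[of "\<lambda>_. 1"] by (simp add: density_1)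

text \<open>Gibbs' inequality: \<open>z ln z\<close> lies above its tangent \<open>z - 1\<close> at 1 and touches it only there, while
\<open>Z - 1\<close> integrates to 0. The tangent also bounds the negative part of \<open>Z ln Z\<close> by 1, so infinite
entropy is the only way in which \<open>Z ln Z\<close> can fail to be integrable.\<close>
lemma (in prob_space)
  assumes Q: "prob_space Q" "sets Q = sets M" "absolutely_continuous M Q"
  shows relative_entropy_nonneg: "0 \<le> relative_entropy Q M"
    and relative_entropy_eq_0_imp: "relative_entropy Q M = 0 \<Longrightarrow> Q = M"
proof -
  interpret Q: prob_space Q by fact
  define Z where "Z \<omega> = enn2real (RN_deriv M Q \<omega>)" for \<omega>
  have [measurable]: "Z \<in> borel_measurable M" unfolding Z_def by measurable
  have Z0: "0 \<le> Z \<omega>" for \<omega> by (simp add: Z_def)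
  have "AE \<omega> in M. RN_deriv M Q \<omega> \<noteq> \<infinity>"
    by (rule RN_deriv_finite) (use Q in \<open>auto intro: Q.sigma_finite_measure_axioms\<close>)
  then have ZR: "AE \<omega> in M. ennreal (Z \<omega>) = RN_deriv M Q \<omega>"
    by eventually_elim (simp add: Z_def less_top)
  have dens: "density M (\<lambda>\<omega>. ennreal (Z \<omega>)) = Q"
    using density_RN_deriv[OF Q(3,2)] density_cong[OF _ _ ZR] by simp
  have nnZ: "(\<integral>\<^sup>+\<omega>. ennreal (Z \<omega>) \<partial>M) = 1"
    using Q.emeasure_space_1 unfolding dens[symmetric] by (simp add: emeasure_density)
  have intZ: "integrable M Z" using nnZ Z0 by (intro integrableI_bounded) auto
  have EZ: "(\<integral>\<omega>. Z \<omega> \<partial>M) = 1" using nnZ Z0 by (simp add: integral_eq_nn_integral)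
  have neg: "(\<integral>\<^sup>+\<omega>. ennreal (- (Z \<omega> * ln (Z \<omega>))) \<partial>M) \<noteq> \<infinity>"
  proof -
    have "(\<integral>\<^sup>+\<omega>. ennreal (- (Z \<omega> * ln (Z \<omega>))) \<partial>M) \<le> (\<integral>\<^sup>+\<omega>. 1 \<partial>M)"
    proof (rule nn_integral_mono)
      fix \<omega>
      have "- (Z \<omega> * ln (Z \<omega>)) \<le> 1" using x_ln_x_ge[OF Z0, of \<omega>] Z0[of \<omega>] by linarith
      from ennreal_leI[OF this] show "ennreal (- (Z \<omega> * ln (Z \<omega>))) \<le> 1" by simp
    qed
    then show ?thesis by (auto simp: emeasure_space_1 top_unique)
  qed
  have "0 \<le> relative_entropy Q M \<and> (relative_entropy Q M = 0 \<longrightarrow> Q = M)"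
  proof (cases "(\<integral>\<^sup>+\<omega>. ennreal (Z \<omega> * ln (Z \<omega>)) \<partial>M) = \<infinity>")
    case True
    have "relative_entropy Q M = \<infinity>"
      using Q(3) True neg unfolding relative_entropy_def Let_def Z_def[symmetric]
      by (cases "\<integral>\<^sup>+\<omega>. ennreal (- (Z \<omega> * ln (Z \<omega>))) \<partial>M") (auto simp: enn2ereal_ennreal)
    then show ?thesis by simp
  next
    case False
    with neg have int: "integrable M (\<lambda>\<omega>. Z \<omega> * ln (Z \<omega>))" by (simp add: real_integrable_def)
    have ent: "relative_entropy Q M = ereal (\<integral>\<omega>. Z \<omega> * ln (Z \<omega>) \<partial>M)"
      using relative_entropy_density[OF _ Z0 int] unfolding dens by simp
    let ?g = "\<lambda>\<omega>. Z \<omega> * ln (Z \<omega>) - (Z \<omega> - 1)"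
    have g_int: "integrable M ?g" using int intZ by simp
    have g: "(\<integral>\<omega>. ?g \<omega> \<partial>M) = (\<integral>\<omega>. Z \<omega> * ln (Z \<omega>) \<partial>M)"
      using int intZ EZ by (simp add: prob_space)
    have g0: "0 \<le> ?g \<omega>" for \<omega> using x_ln_x_ge[OF Z0, of \<omega>] by simp
    have "0 \<le> (\<integral>\<omega>. ?g \<omega> \<partial>M)" using g0 by (intro integral_nonneg_AE AE_I2)
    then have "0 \<le> relative_entropy Q M" unfolding ent g by simp
    moreover have "Q = M" if "relative_entropy Q M = 0"
    proof -
      have "(\<integral>\<omega>. ?g \<omega> \<partial>M) = 0" using that unfolding ent g by simp
      then have "AE \<omega> in M. ?g \<omega> = 0"
        using integral_nonneg_eq_0_iff_AE[OF g_int] g0 by simp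
      then have "AE \<omega> in M. ennreal (Z \<omega>) = 1"
        by eventually_elim (use x_ln_x_eq[OF Z0] in simp)
      then have "density M (\<lambda>\<omega>. ennreal (Z \<omega>)) = density M (\<lambda>_. 1)" by (intro density_cong) auto
      then show ?thesis unfolding dens by (simp add: density_1)
    qed
    ultimately show ?thesis by blast
  qed
  then show "0 \<le> relative_entropy Q M" "relative_entropy Q M = 0 \<Longrightarrow> Q = M" by auto
qed

section \<open>Removing the mean at small entropy cost\<close>

text \<open>If the probabilities of all the later unit intervals were below \<open>exp (- \<delta> n)\<close>, the exponential
moment of order \<open>\<delta> / 2\<close> would be dominated by a geometric series. The intervals are bounded, so that
the part of X in one of them is integrable.\<close>
lemma (in prob_space) unit_interval_prob_ge_exp:
  assumes [measurable]: "X \<in> borel_measurable M"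
    and no_moment: "\<And>\<kappa>::real. 0 < \<kappa> \<Longrightarrow> (\<integral>\<^sup>+\<omega>. ennreal (exp (\<kappa> * X \<omega>)) \<partial>M) = \<infinity>" and "0 < \<delta>"
  shows "\<exists>n\<ge>N. exp (- \<delta> * real n) \<le> prob {\<omega>\<in>space M. real n < X \<omega> \<and> X \<omega> \<le> real n + 1}"
proof (rule ccontr)
  let ?B = "\<lambda>n. {\<omega>\<in>space M. real n < X \<omega> \<and> X \<omega> \<le> real n + 1}"
  assume "\<not> ?thesis"
  then have small: "prob (?B n) \<le> exp (- \<delta> * real n)" if "N \<le> n" for n using that by (meson not_le less_imp_le)
  define \<kappa> where "\<kappa> = \<delta> / 2"
  have "\<kappa> > 0" using \<open>0 < \<delta>\<close> by (simp add: \<kappa>_def)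
  have \<delta>: "\<delta> = 2 * \<kappa>" by (simp add: \<kappa>_def)
  define g :: "nat \<Rightarrow> 'a \<Rightarrow> ennreal"
    where "g n \<omega> = ennreal (exp (\<kappa> * (real (n + N) + 1))) * indicator (?B (n + N)) \<omega>" for n \<omega>
  have [measurable]: "g n \<in> borel_measurable M" for n unfolding g_def by measurable
  have "(\<integral>\<^sup>+\<omega>. ennreal (exp (\<kappa> * X \<omega>)) \<partial>M) \<le> (\<integral>\<^sup>+\<omega>. ennreal (exp (\<kappa> * N)) + (\<Sum>n. g n \<omega>) \<partial>M)"
  proof (rule nn_integral_mono)
    fix \<omega> assume \<omega>: "\<omega> \<in> space M"
    show "ennreal (exp (\<kappa> * X \<omega>)) \<le> ennreal (exp (\<kappa> * N)) + (\<Sum>n. g n \<omega>)"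
    proof (cases "X \<omega> \<le> N")
      case True
      then have "ennreal (exp (\<kappa> * X \<omega>)) \<le> ennreal (exp (\<kappa> * N)) + 0"
        using \<open>\<kappa> > 0\<close> by (auto intro!: ennreal_leI)
      also have "\<dots> \<le> ennreal (exp (\<kappa> * N)) + (\<Sum>n. g n \<omega>)" by (intro add_left_mono) simp
      finally show ?thesis .
    next
      case False
      \<comment> \<open>The interval that contains \<open>X \<omega>\<close> is open on the left, hence the ceiling minus 1.\<close>
      define k where "k = nat (\<lceil>X \<omega>\<rceil> - 1) - N"
      have "X \<omega> > N" using False by simp
      then have "int N \<le> \<lceil>X \<omega>\<rceil> - 1" by linarith
      then have k: "real (k + N) = of_int (\<lceil>X \<omega>\<rceil> - 1)" unfolding k_def by simp
      have B: "\<omega> \<in> ?B (k + N)" unfolding k using \<omega> by simp linarith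
      then have "ennreal (exp (\<kappa> * X \<omega>)) \<le> g k \<omega>"
        using \<open>\<kappa> > 0\<close> by (auto simp: g_def intro!: ennreal_leI)
      also have "\<dots> = (\<Sum>n\<in>{k}. g n \<omega>)" by simp
      also have "\<dots> \<le> (\<Sum>n. g n \<omega>)" by (intro sum_le_suminf) auto
      also have "\<dots> \<le> ennreal (exp (\<kappa> * N)) + (\<Sum>n. g n \<omega>)" by simp
      finally show ?thesis .
    qed
  qed
  also have "\<dots> = ennreal (exp (\<kappa> * N)) + (\<Sum>n. \<integral>\<^sup>+\<omega>. g n \<omega> \<partial>M)"
    by (subst nn_integral_add) (auto simp: emeasure_space_1 nn_integral_suminf)
  also have "(\<Sum>n. \<integral>\<^sup>+\<omega>. g n \<omega> \<partial>M) \<le> (\<Sum>n. ennreal (exp \<kappa> * exp (- \<kappa>) ^ n))"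
  proof (intro suminf_le allI)
    fix n
    have "(\<integral>\<^sup>+\<omega>. g n \<omega> \<partial>M) = ennreal (exp (\<kappa> * (real (n + N) + 1))) * emeasure M (?B (n + N))"
      unfolding g_def by (subst nn_integral_cmult_indicator) auto
    also have "\<dots> \<le> ennreal (exp (\<kappa> * (real (n + N) + 1))) * ennreal (exp (- \<delta> * real (n + N)))"
      unfolding emeasure_eq_measure by (intro mult_left_mono ennreal_leI small) auto
    also have "\<dots> = ennreal (exp (\<kappa> - \<kappa> * real (n + N)))"
      by (simp add: ennreal_mult[symmetric] exp_add[symmetric] \<delta> algebra_simps)
    also have "\<dots> \<le> ennreal (exp (\<kappa> - \<kappa> * real n))"
      using \<open>\<kappa> > 0\<close> by (intro ennreal_leI) simp
    also have "exp (\<kappa> - \<kappa> * real n) = exp \<kappa> * exp (- \<kappa>) ^ n"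
      by (simp add: exp_of_nat_mult[symmetric] exp_add[symmetric] algebra_simps)
    finally show "(\<integral>\<^sup>+\<omega>. g n \<omega> \<partial>M) \<le> ennreal (exp \<kappa> * exp (- \<kappa>) ^ n)" .
  qed auto
  also have "(\<Sum>n. ennreal (exp \<kappa> * exp (- \<kappa>) ^ n)) < \<infinity>"
  proof -
    have "summable (\<lambda>n. exp \<kappa> * exp (- \<kappa>) ^ n)"
      using \<open>\<kappa> > 0\<close> by (intro summable_mult summable_geometric) simp
    then show ?thesis by (subst suminf_ennreal2) auto
  qed
  finally have "(\<integral>\<^sup>+\<omega>. ennreal (exp (\<kappa> * X \<omega>)) \<partial>M) < \<infinity>" by simp
  with no_moment[OF \<open>\<kappa> > 0\<close>] show False by simp
qed

text \<open>The last two conjuncts say that the reweighted measure has relative entropy at most e with respect to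
the original one.\<close>
definition centring_density :: "'a measure \<Rightarrow> ('a \<Rightarrow> real) \<Rightarrow> real \<Rightarrow> ('a \<Rightarrow> real) \<Rightarrow> bool" where
  "centring_density P X e Z \<longleftrightarrow>
     Z \<in> borel_measurable P \<and> (\<forall>\<omega>. 0 \<le> Z \<omega>) \<and> integrable P Z \<and> (\<integral>\<omega>. Z \<omega> \<partial>P) = 1 \<and>
     integrable P (\<lambda>\<omega>. Z \<omega> * X \<omega>) \<and> (\<integral>\<omega>. Z \<omega> * X \<omega> \<partial>P) = 0 \<and>
     integrable P (\<lambda>\<omega>. Z \<omega> * ln (Z \<omega>)) \<and> (\<integral>\<omega>. Z \<omega> * ln (Z \<omega>) \<partial>P) \<le> e"

text \<open>The density mixes the law conditioned on a central event A with the law conditioned on a far event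
B. If c and d are the means of X on these events, with \<open>c \<le> 0\<close>, then the weight
\<open>a = - c / (d - c)\<close> of B makes the mixture centred, and it is at most \<open>- c / n\<close> if B lies beyond n.
Half of the entropy budget e pays for the conditioning on A; the other half pays for B, where the
cost is at most \<open>a (- ln q) \<le> (- c / n) \<delta> n\<close> for q the probability of B. This dictates the choice
of \<open>\<delta>\<close>.\<close>
lemma (in prob_space) centring_density_one_sided:
  assumes X [measurable]: "X \<in> borel_measurable M"
    and no_moment: "\<And>\<kappa>::real. 0 < \<kappa> \<Longrightarrow> (\<integral>\<^sup>+\<omega>. ennreal (exp (\<kappa> * X \<omega>)) \<partial>M) = \<infinity>"
    and "0 < e" and A_def: "A = {\<omega>\<in>space M. \<bar>X \<omega>\<bar> \<le> real K}" and pA: "exp (- e / 2) \<le> prob A"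
    and neg: "(\<integral>\<omega>. indicator A \<omega> * X \<omega> \<partial>M) \<le> 0"
  shows "\<exists>Z. centring_density M X e Z"
proof -
  define p where "p = prob A"
  define c where "c = (\<integral>\<omega>. indicator A \<omega> * X \<omega> \<partial>M) / p"
  have "0 < p" using pA less_le_trans[OF exp_gt_zero] by (simp add: p_def)
  have "p \<le> 1" by (simp add: p_def)
  have lnp: "- ln p \<le> e / 2" 
  proof -
    have "- e / 2 \<le> ln p" using pA \<open>0 < p\<close> by (subst ln_ge_iff) (simp_all add: p_def)
    then show ?thesis by simp
  qed
  have "c \<le> 0" using neg \<open>0 < p\<close> by (simp add: c_def divide_nonpos_pos)
  define \<delta> where "\<delta> = e / (2 * (1 - c))"
  have "0 < \<delta>" using \<open>0 < e\<close> \<open>c \<le> 0\<close> by (simp add: \<delta>_def)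
  \<comment> \<open>Starting beyond \<open>K\<close> keeps B disjoint from A, and \<open>n\<close> positive.\<close>
  obtain n where n: "Suc K \<le> n"
    and q_ge: "exp (- \<delta> * real n) \<le> prob {\<omega>\<in>space M. real n < X \<omega> \<and> X \<omega> \<le> real n + 1}"
    using unit_interval_prob_ge_exp[OF X no_moment \<open>0 < \<delta>\<close>, of "Suc K"] by blast
  define B where "B = {\<omega>\<in>space M. real n < X \<omega> \<and> X \<omega> \<le> real n + 1}"
  define q where "q = prob B"
  have "0 < q" using q_ge less_le_trans[OF exp_gt_zero] by (simp add: q_def B_def)
  have "q \<le> 1" by (simp add: q_def)
  have lnq: "- ln q \<le> \<delta> * n" 
  proof -
    have "- \<delta> * n \<le> ln q" using q_ge \<open>0 < q\<close> by (subst ln_ge_iff) (simp_all add: q_def B_def)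
    then show ?thesis by simp
  qed
  have [measurable]: "A \<in> events" "B \<in> events" unfolding A_def B_def by measurable
  have disj: "A \<inter> B = {}" using n by (auto simp: A_def B_def)
  have AX: "integrable M (\<lambda>\<omega>. indicator A \<omega> * X \<omega>)"
    by (rule integrable_const_bound[where B = K]) (auto simp: A_def indicator_def)
  have BX: "integrable M (\<lambda>\<omega>. indicator B \<omega> * X \<omega>)"
    by (rule integrable_const_bound[where B = "real n + 1"]) (auto simp: B_def indicator_def)
  define d where "d = (\<integral>\<omega>. indicator B \<omega> * X \<omega> \<partial>M) / q"
  have "real n * q = (\<integral>\<omega>. real n * indicat_real B \<omega> \<partial>M)" by (simp add: q_def)
  also have "\<dots> \<le> (\<integral>\<omega>. indicator B \<omega> * X \<omega> \<partial>M)"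
    using BX by (intro integral_mono) (auto simp: B_def emeasure_eq_measure split: split_indicator)
  finally have "real n \<le> d" using \<open>0 < q\<close> by (simp add: d_def pos_le_divide_eq)
  then have "0 < d" using n by linarith
  define a where "a = - c / (d - c)"
  have a: "0 \<le> a" "a \<le> 1" using \<open>c \<le> 0\<close> \<open>0 < d\<close> by (auto simp: a_def divide_nonpos_pos field_simps)
  have ad: "a * (d - c) = - c" using \<open>c \<le> 0\<close> \<open>0 < d\<close> by (simp add: a_def)
  have an: "a * n \<le> - c"
  proof -
    have "a * n \<le> a * (d - c)" using \<open>real n \<le> d\<close> \<open>c \<le> 0\<close> a(1) by (intro mult_left_mono) auto
    then show ?thesis using ad by simp
  qed
  define u where "u = (1 - a) / p"
  define v where "v = a / q"
  have u: "0 \<le> u" "u * p = 1 - a" and v: "0 \<le> v" "v * q = a"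
    using a \<open>0 < p\<close> \<open>0 < q\<close> by (auto simp: u_def v_def)
  define Z where "Z \<omega> = u * indicator A \<omega> + v * indicator B \<omega>" for \<omega>
  have ZX: "Z \<omega> * X \<omega> = u * (indicator A \<omega> * X \<omega>) + v * (indicator B \<omega> * X \<omega>)" for \<omega>
    by (simp add: Z_def algebra_simps)
  have Zln: "Z \<omega> * ln (Z \<omega>) = u * ln u * indicator A \<omega> + v * ln v * indicator B \<omega>" for \<omega>
    using disj by (auto simp: Z_def indicator_def)
  have indAB: "integrable M (indicat_real A)" "integrable M (indicat_real B)" by (auto simp: emeasure_eq_measure)
  have "(\<integral>\<omega>. Z \<omega> \<partial>M) = u * p + v * q"
    unfolding Z_def using indAB by (simp add: p_def q_def)
  then have EZ: "(\<integral>\<omega>. Z \<omega> \<partial>M) = 1" using u v by simp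
  have "(\<integral>\<omega>. Z \<omega> * X \<omega> \<partial>M) = u * (c * p) + v * (d * q)"
    unfolding ZX using AX BX \<open>0 < p\<close> \<open>0 < q\<close> by (simp add: c_def d_def)
  also have "\<dots> = (u * p) * c + (v * q) * d" by (simp add: algebra_simps)
  also have "\<dots> = 0" unfolding u v using ad by (simp add: algebra_simps)
  finally have EZX: "(\<integral>\<omega>. Z \<omega> * X \<omega> \<partial>M) = 0" .
  have "(\<integral>\<omega>. Z \<omega> * ln (Z \<omega>) \<partial>M) = u * ln u * p + v * ln v * q"
    unfolding Zln using indAB by (simp add: p_def q_def)
  also have "\<dots> = (u * p) * ln u + (v * q) * ln v" by (simp add: algebra_simps)
  also have "\<dots> = (1 - a) * ln u + a * ln v" unfolding u v ..
  also have "(1 - a) * ln u \<le> e / 2"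
  proof (cases "a = 1")
    case False
    then have "0 < 1 - a" using a by simp
    then have "(1 - a) * ln u = (1 - a) * ln (1 - a) + (1 - a) * (- ln p)"
      using \<open>0 < p\<close> by (simp add: u_def ln_div algebra_simps)
    also have "\<dots> \<le> 0 + 1 * (- ln p)"
      using \<open>0 < 1 - a\<close> a \<open>0 < p\<close> \<open>p \<le> 1\<close>
      by (intro add_mono mult_right_mono mult_nonneg_nonpos) auto
    finally show ?thesis using lnp by simp
  qed (use \<open>0 < e\<close> in simp)
  also have "a * ln v \<le> e / 2"
  proof (cases "a = 0")
    case False
    then have "0 < a" using a by simp
    then have "a * ln v = a * ln a + a * (- ln q)"
      using \<open>0 < q\<close> by (simp add: v_def ln_div algebra_simps)
    also have "\<dots> \<le> 0 + a * (\<delta> * n)"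
      using \<open>0 < a\<close> a lnq by (intro add_mono mult_left_mono mult_nonneg_nonpos) auto
    also have "\<dots> = (a * n) * \<delta>" by simp
    also have "\<dots> \<le> (1 - c) * \<delta>" using an \<open>0 < \<delta>\<close> by (intro mult_right_mono) auto
    also have "\<dots> = e / 2"
      unfolding \<delta>_def times_divide_eq_right mult.commute[of 2]
      by (rule nonzero_mult_divide_mult_cancel_left) (use \<open>c \<le> 0\<close> in simp)
    finally show ?thesis .
  qed (use \<open>0 < e\<close> in simp)
  finally have ent: "(\<integral>\<omega>. Z \<omega> * ln (Z \<omega>) \<partial>M) \<le> e" by simp
  have "centring_density M X e Z"
    unfolding centring_density_def
  proof (intro conjI EZ EZX ent allI)
    show "Z \<in> borel_measurable M" unfolding Z_def by measurable
    show "0 \<le> Z \<omega>" for \<omega> using u v by (simp add: Z_def)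
    show "integrable M Z" unfolding Z_def using indAB by simp
    show "integrable M (\<lambda>\<omega>. Z \<omega> * X \<omega>)" unfolding ZX using AX BX by simp
    show "integrable M (\<lambda>\<omega>. Z \<omega> * ln (Z \<omega>))" unfolding Zln using indAB by simp
  qed
  then show ?thesis by blast
qed

lemma (in prob_space) exists_centring_density:
  assumes X [measurable]: "X \<in> borel_measurable M"
    and no_moment: "\<And>\<kappa>::real. \<kappa> \<noteq> 0 \<Longrightarrow> (\<integral>\<^sup>+\<omega>. ennreal (exp (\<kappa> * X \<omega>)) \<partial>M) = \<infinity>"
    and "0 < e"
  shows "\<exists>Z. centring_density M X e Z"
proof -
  obtain K :: nat where K: "exp (- e / 2) \<le> prob {\<omega>\<in>space M. \<bar>X \<omega>\<bar> \<le> real K}"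
    using exists_prob_abs_le[OF X, of "exp (- e / 2)"] \<open>0 < e\<close> by auto
  let ?A = "{\<omega>\<in>space M. \<bar>X \<omega>\<bar> \<le> real K}"
  show ?thesis
  proof (cases "(\<integral>\<omega>. indicator ?A \<omega> * X \<omega> \<partial>M) \<le> 0")
    case True
    show ?thesis
      by (rule centring_density_one_sided[OF X no_moment \<open>0 < e\<close> refl K True]) simp
  next
    case False
    have "\<exists>Z. centring_density M (\<lambda>\<omega>. - X \<omega>) e Z"
    proof (rule centring_density_one_sided[OF _ _ \<open>0 < e\<close> refl])
      show "(\<integral>\<^sup>+\<omega>. ennreal (exp (\<kappa> * - X \<omega>)) \<partial>M) = \<infinity>" if "0 < \<kappa>" for \<kappa> :: real
        using no_moment[of "- \<kappa>"] that by simp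
    qed (use K False in auto)
    then show ?thesis unfolding centring_density_def by auto
  qed
qed

section \<open>Membership of the base measure in the class\<close>

lemma subalgebra_restr_to_subalg:
  assumes "subalgebra M G" "space H = space M" "sets H \<subseteq> sets G"
  shows "subalgebra (restr_to_subalg M G) H"
  using assms by (simp add: subalgebra_def space_restr_to_subalg sets_restr_to_subalg)

lemma distr_restr_to_subalg:
  assumes G: "subalgebra M G" and X: "X \<in> borel_measurable G"
  shows "distr (restr_to_subalg M G) borel X = distr M borel (X :: 'a \<Rightarrow> real)"
proof (rule measure_eqI)
  fix B assume "B \<in> sets (distr (restr_to_subalg M G) borel X)"
  then have B: "B \<in> sets borel" by simp
  have "X -` B \<inter> space M \<in> sets G"
    using measurable_sets[OF X B] G by (simp add: subalgebra_def)
  then show "emeasure (distr (restr_to_subalg M G) borel X) B = emeasure (distr M borel X) B"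
    using emeasure_distr[OF measurable_in_subalg[OF G X] B] emeasure_distr[OF measurable_from_subalg[OF G X] B]
    by (simp add: space_restr_to_subalg emeasure_restr_to_subalg[OF G])
qed simp

text \<open>The measures of the class live on F T, so P takes the place of M in their comparison. Since P is again
the base measure of a Levy process, all results above apply to it.\<close>
lemma (in levy_process) levy_process_restricted: "levy_process (P_at M F T) F T L"
proof -
  let ?P = "P_at M F T"
  have T: "T \<in> {0..T}" using horizon_pos by simp
  note G = subalgebra_F[OF T]
  have sets_P: "sets ?P = sets (F T)" by (rule sets_restr_to_subalg[OF G])
  have space_P: "space ?P = space M" by (rule space_restr_to_subalg)
  have FT: "L t \<in> borel_measurable (F T)" if t: "t \<in> {0..T}" for t
  proof (rule measurable_from_subalg[OF _ adapted[OF t]])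
    show "subalgebra (F T) (F t)"
      using F_mono[of t T] t space_F[OF t] space_F[OF T] by (simp add: subalgebra_def)
  qed
  have inc: "(\<lambda>\<omega>. L t \<omega> - L s \<omega>) \<in> borel_measurable (F T)" if "0 \<le> s" "s \<le> t" "t \<le> T" for s t
    using that by (intro borel_measurable_diff FT) auto
  interpret P: prob_space ?P by (rule prob_space_restr_to_subalg[OF G prob_space_axioms])
  have prob_P: "P.prob A = prob A" if "A \<in> sets (F T)" for A
    using emeasure_restr_to_subalg[OF G that] by (simp add: measure_def)
  show ?thesis
  proof unfold_locales
    show "0 < T" by (rule horizon_pos)
    show "subalgebra ?P (F t)" if "t \<in> {0..T}" for t
      using that F_mono[of t T] by (intro subalgebra_restr_to_subalg[OF G space_F[OF that]]) auto
    show "sets (F s) \<subseteq> sets (F t)" if "0 \<le> s" "s \<le> t" "t \<le> T" for s t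
      by (rule F_mono[OF that])
    show "L t \<in> borel_measurable (F t)" if "t \<in> {0..T}" for t by (rule adapted[OF that])
    show "cadlag_on T (\<lambda>t. L t \<omega>)" "L 0 \<omega> = 0" if "\<omega> \<in> space ?P" for \<omega>
      using cadlag_paths start_zero that unfolding space_P by auto
    show "distr ?P borel (\<lambda>\<omega>. L t \<omega> - L s \<omega>) = distr ?P borel (L (t - s))"
      if st: "0 \<le> s" "s \<le> t" "t \<le> T" for s t
    proof -
      have "L (t - s) \<in> borel_measurable (F T)" using st by (intro FT) auto
      then show ?thesis
        unfolding distr_restr_to_subalg[OF G inc[OF st]] using distr_restr_to_subalg[OF G]
          stationary_increments[OF st] by metis
    qed
    show "P.indep_set (sets (F s)) (sets (vimage_algebra (space ?P) (\<lambda>\<omega>. L t \<omega> - L s \<omega>) borel))"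
      if st: "0 \<le> s" "s \<le> t" "t \<le> T" for s t
    proof -
      let ?V = "vimage_algebra (space M) (\<lambda>\<omega>. L t \<omega> - L s \<omega>) borel"
      have "?V = vimage_algebra (space (F T)) (\<lambda>\<omega>. L t \<omega> - L s \<omega>) borel" by (simp add: space_F[OF T])
      then have V: "sets ?V \<subseteq> sets (F T)"
        using measurable_iff_sets[THEN iffD1, OF inc[OF st]] by simp
      have s: "sets (F s) \<subseteq> sets (F T)" using st by (intro F_mono) auto
      show ?thesis unfolding P.indep_sets2_eq sets_P space_P
      proof (intro conjI s V ballI)
        fix A B assume A: "A \<in> sets (F s)" and B: "B \<in> sets ?V"
        have "A \<in> sets (F T)" "B \<in> sets (F T)" using A B s V by auto
        then show "P.prob (A \<inter> B) = P.prob A * P.prob B"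
          using indep_setD[OF independent_increments[OF st] A B] by (simp add: prob_P sets.Int)
      qed
    qed
  qed
qed

context levy_process
begin

lemma stopping_times_reach_horizon:
  fixes \<tau> :: "nat \<Rightarrow> 'a \<Rightarrow> real"
  assumes \<tau>: "\<And>k. stopping_time_on F T (\<tau> k)"
    and inc: "incseq (\<lambda>k. {\<omega>\<in>space M. \<tau> k \<omega> = T})"
    and reach: "AE \<omega> in M. \<exists>k. \<tau> k \<omega> = T"
  obtains k where "prob {\<omega>\<in>space M. \<tau> k \<omega> < T} \<le> 1/4"
proof -
  note [measurable] = stopping_time_borel_measurable[OF \<tau>]
  have "(\<lambda>k. prob {\<omega>\<in>space M. \<tau> k \<omega> = T}) \<longlonglongrightarrow> prob (\<Union>k. {\<omega>\<in>space M. \<tau> k \<omega> = T})"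
    by (rule finite_Lim_measure_incseq[OF _ inc]) auto
  also have "prob (\<Union>k. {\<omega>\<in>space M. \<tau> k \<omega> = T}) = 1"
    using reach by (intro prob_eq_1[THEN iffD2]) auto
  finally have "eventually (\<lambda>k. 3/4 < prob {\<omega>\<in>space M. \<tau> k \<omega> = T}) sequentially"
    by (rule order_tendstoD) simp
  then obtain k where k: "3/4 < prob {\<omega>\<in>space M. \<tau> k \<omega> = T}" by (auto simp: eventually_sequentially)
  have "{\<omega>\<in>space M. \<tau> k \<omega> < T} = space M - {\<omega>\<in>space M. \<tau> k \<omega> = T}"
    using stopping_time_range[OF \<tau>, of k] by (auto simp: less_le)
  then have "prob {\<omega>\<in>space M. \<tau> k \<omega> < T} = 1 - prob {\<omega>\<in>space M. \<tau> k \<omega> = T}"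
    using prob_compl[of "{\<omega>\<in>space M. \<tau> k \<omega> = T}"] by simp
  with k show ?thesis by (intro that[of k]) simp
qed

lemma local_martingale_imp_terminal_mean_zero:
  assumes "local_martingale_on M F T L"
  shows "integrable M (L T)" "(\<integral>\<omega>. L T \<omega> \<partial>M) = 0"
proof -
  obtain \<tau> :: "nat \<Rightarrow> 'a \<Rightarrow> real" where \<tau>: "\<And>k. stopping_time_on F T (\<tau> k)"
    and inc: "\<And>\<omega>. \<omega> \<in> space M \<Longrightarrow> incseq (\<lambda>k. \<tau> k \<omega>)"
    and reach: "AE \<omega> in M. \<exists>k. \<tau> k \<omega> = T"
    and mart: "\<And>k. martingale_on M F T (\<lambda>t \<omega>. L (min t (\<tau> k \<omega>)) \<omega>)"
    using assms unfolding local_martingale_on_def by blast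
  have T: "0 \<le> T" "0 \<in> {0..T}" using horizon_pos by auto
  have "incseq (\<lambda>k. {\<omega>\<in>space M. \<tau> k \<omega> = T})"
  proof (rule incseq_SucI, safe)
    fix k \<omega> assume "\<omega> \<in> space M" and eq: "T = \<tau> k \<omega>"
    then show "\<tau> (Suc k) \<omega> = \<tau> k \<omega>"
      using incseq_SucD[OF inc, of \<omega> k] stopping_time_range[OF \<tau>, of "Suc k" \<omega>] by auto
  qed
  then obtain k where k: "prob {\<omega>\<in>space M. \<tau> k \<omega> < T} \<le> 1/4"
    using stopping_times_reach_horizon[OF \<tau> _ reach] by blast
  have min: "min T (\<tau> k \<omega>) = \<tau> k \<omega>" "min 0 (\<tau> k \<omega>) = 0" for \<omega>
    using stopping_time_range[OF \<tau>, of k \<omega>] by auto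
  have zero: "(\<integral>\<omega>. L 0 \<omega> \<partial>M) = (\<integral>\<omega>. 0 \<partial>M)" by (intro Bochner_Integration.integral_cong refl start_zero)
  have "integrable M (\<lambda>\<omega>. L (\<tau> k \<omega>) \<omega>)" "(\<integral>\<omega>. L (\<tau> k \<omega>) \<omega> \<partial>M) = 0"
    using martingale_on_mean[OF mart[of k] T(1) subalgebra_F[OF T(2)]] zero unfolding min by simp_all
  from terminal_mean_zero_of_stopped[OF \<tau> k this]
  show "integrable M (L T)" "(\<integral>\<omega>. L T \<omega> \<partial>M) = 0" by auto
qed

lemma martingale_imp_local_martingale:
  assumes "martingale_on M F T L"
  shows "local_martingale_on M F T L"
  unfolding local_martingale_on_def
proof (intro exI[of _ "\<lambda>_ _. T"] conjI allI ballI)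
  show "stopping_time_on F T (\<lambda>_. T)" using horizon_pos by (auto simp: stopping_time_on_def stopping_time_def)
  show "martingale_on M F T (\<lambda>t \<omega>. L (min t T) \<omega>)"
    using assms unfolding martingale_on_def by (simp add: min_absorb1)
qed (auto simp: incseq_def)

text \<open>Both parts of the class provide stopping times that reach T with probability tending to 1 and at which
L has mean 0, so they are treated alike.\<close>
lemma base_measure_in_M_hat_loc_iff:
  assumes sets_M: "sets M = sets (F T)" and P: "P_at M F T = M"
  shows "M \<in> M_hat_loc M F T L \<longleftrightarrow> integrable M (L T) \<and> (\<integral>\<omega>. L T \<omega> \<partial>M) = 0"
proof
  assume "M \<in> M_hat_loc M F T L"
  then consider "local_martingale_on M F T L" | "M \<in> M_tilde_loc M F T L"
    by (auto simp: M_hat_loc_def M_loc_def)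
  then show "integrable M (L T) \<and> (\<integral>\<omega>. L T \<omega> \<partial>M) = 0"
  proof cases
    case 1
    then show ?thesis using local_martingale_imp_terminal_mean_zero by blast
  next
    case 2
    then obtain \<tau> :: "nat \<Rightarrow> 'a \<Rightarrow> real" where stop: "\<forall>k. stopping_time_on F T (\<tau> k)"
      and inc: "incseq (\<lambda>k. {\<omega>\<in>space M. \<tau> k \<omega> = T})"
      and reach: "(\<Union>k. {\<omega>\<in>space M. \<tau> k \<omega> = T}) = space M"
      and stopped: "\<forall>k. integrable M (\<lambda>\<omega>. L (min (\<tau> k \<omega>) T) \<omega>) \<and>
        (\<integral>\<omega>. L (min (\<tau> k \<omega>) T) \<omega> \<partial>M) = 0"
      unfolding M_tilde_loc_def mem_Collect_eq by blast
    from stop have \<tau>: "stopping_time_on F T (\<tau> k)" for k ..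
    have "AE \<omega> in M. \<exists>k. \<tau> k \<omega> = T" using reach by (intro AE_I2) blast
    then obtain k where k: "prob {\<omega>\<in>space M. \<tau> k \<omega> < T} \<le> 1/4"
      using stopping_times_reach_horizon[OF \<tau> inc] by blast
    have min: "min (\<tau> k \<omega>) T = \<tau> k \<omega>" for \<omega> using stopping_time_range[OF \<tau>, of k \<omega>] by auto
    have "integrable M (\<lambda>\<omega>. L (\<tau> k \<omega>) \<omega>)" "(\<integral>\<omega>. L (\<tau> k \<omega>) \<omega> \<partial>M) = 0"
      using stopped[THEN spec, of k] unfolding min by auto
    from terminal_mean_zero_of_stopped[OF \<tau> k this] show ?thesis by blast
  qed
next
  assume "integrable M (L T) \<and> (\<integral>\<omega>. L T \<omega> \<partial>M) = 0"
  then have "local_martingale_on M F T L"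
    using martingale_imp_local_martingale martingale_iff_terminal_mean_zero by blast
  moreover have "M \<in> ac_prob_measures M F T"
    using prob_space_axioms sets_M by (simp add: ac_prob_measures_def P absolutely_continuous_def)
  ultimately show "M \<in> M_hat_loc M F T L" by (simp add: M_hat_loc_def M_loc_def)
qed

end

text \<open>The constant stopping times T witness membership: they reduce the requirement to a centred \<open>L T\<close>.\<close>
lemma (in prob_space) centring_density_in_M_tilde_loc:
  assumes Z: "centring_density M (L T) e Z" and sets_M: "sets M = sets (F T)" and "P_at N F T = M" and "0 \<le> T"
    and L [measurable]: "L T \<in> borel_measurable M"
  shows "density M (\<lambda>\<omega>. ennreal (Z \<omega>)) \<in> M_tilde_loc N F T L" (is "?Q \<in> _")
proof -
  have [measurable]: "Z \<in> borel_measurable M" and Z0: "\<And>\<omega>. 0 \<le> Z \<omega>" and "integrable M Z" "(\<integral>\<omega>. Z \<omega> \<partial>M) = 1"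
    and ZL: "integrable M (\<lambda>\<omega>. Z \<omega> * L T \<omega>)" "(\<integral>\<omega>. Z \<omega> * L T \<omega> \<partial>M) = 0"
    using Z by (auto simp: centring_density_def)
  then have "(\<integral>\<^sup>+\<omega>. ennreal (Z \<omega>) \<partial>M) = 1"
    using nn_integral_eq_integral[OF \<open>integrable M Z\<close>] by simp
  then have prob: "prob_space ?Q" by (intro prob_spaceI) (simp add: emeasure_density)
  have int: "integrable ?Q (L T)" using ZL Z0 by (subst integrable_density) auto
  have mean: "(\<integral>\<omega>. L T \<omega> \<partial>?Q) = 0" using ZL Z0 by (subst integral_density) auto
  have "stopping_time_on F T (\<lambda>_. T)" using \<open>0 \<le> T\<close> by (auto simp: stopping_time_on_def stopping_time_def)
  moreover have "absolutely_continuous (P_at N F T) ?Q"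
    unfolding \<open>P_at N F T = M\<close> by (rule absolutely_continuousI_density) simp
  ultimately show ?thesis
    unfolding M_tilde_loc_def ac_prob_measures_def using prob int mean sets_M
    by (auto intro!: exI[of _ "\<lambda>_ _. T"] simp: incseq_def)
qed

theorem corollary4p9:
  fixes M :: "'a measure" and F :: "real \<Rightarrow> 'a measure" and T :: real
    and L :: "real \<Rightarrow> 'a \<Rightarrow> real"
  assumes "levy_process M F T L"
    and "{\<kappa> :: real. exp_moment M T L \<kappa> < \<infinity>} = {0}"
  shows
    "let P = P_at M F T;
         C = M_hat_loc M F T L;
         i = (\<exists>Q. is_MEMM P C Q \<and> is_EMM M F T L Q);
         ii = martingale_on M F T L;
         iii = (integrable M (L T) \<and> (\<integral>\<omega>. L T \<omega> \<partial>M) = 0);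
         iv = is_EMM M F T L P
     in (i \<longleftrightarrow> ii) \<and> (ii \<longleftrightarrow> iii) \<and> (iii \<longleftrightarrow> iv) \<and>
        (iii \<longrightarrow> (\<forall>t\<in>{0..T}. integrable M (L t) \<and> (\<integral>\<omega>. L t \<omega> \<partial>M) = 0)) \<and>
        (i \<or> ii \<or> iii \<or> iv \<longrightarrow> is_MEMM P C P \<and> (\<forall>Q. is_MEMM P C Q \<longrightarrow> Q = P)) \<and>
        (\<not> (i \<or> ii \<or> iii \<or> iv) \<longrightarrow>
           (\<nexists>Q. is_MEMM P C Q) \<and> (\<nexists>Q. is_EMM M F T L Q))"
proof -
  interpret levy_process M F T L by fact
  define P where "P = P_at M F T"
  define C where "C = M_hat_loc M F T L"
  define iii where "iii \<longleftrightarrow> integrable M (L T) \<and> (\<integral>\<omega>. L T \<omega> \<partial>M) = 0"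
  have T: "T \<in> {0..T}" "0 \<le> T" using horizon_pos by auto
  note G = subalgebra_F[OF T(1)]
  interpret P: levy_process P F T L unfolding P_def by (rule levy_process_restricted)
  have sets_P: "sets P = sets (F T)" unfolding P_def by (rule sets_restr_to_subalg[OF G])
  have P_at_P: "P_at P F T = P"
  proof (rule measure_eqI)
    show "sets (P_at P F T) = sets P" using sets_P by (simp add: sets_restr_to_subalg[OF P.subalgebra_F[OF T(1)]])
    show "emeasure (P_at P F T) A = emeasure P A" if "A \<in> sets (P_at P F T)" for A
      using that emeasure_restr_to_subalg[OF P.subalgebra_F[OF T(1)]]
      by (simp add: sets_restr_to_subalg[OF P.subalgebra_F[OF T(1)]])
  qed
  have C_P: "C = M_hat_loc P F T L"
    unfolding C_def M_hat_loc_def M_loc_def M_tilde_loc_def ac_prob_measures_def P_at_P P_def[symmetric] ..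
  have LT: "L T \<in> borel_measurable P" by (rule P.L_measurable[OF T(1)])
  have int_P: "integrable P (L T) \<longleftrightarrow> integrable M (L T)"
    using integrable_from_subalg[OF G] integrable_in_subalg[OF G adapted[OF T(1)]] unfolding P_def by blast
  have mean_P: "(\<integral>\<omega>. L T \<omega> \<partial>P) = (\<integral>\<omega>. L T \<omega> \<partial>M)"
    unfolding P_def by (rule integral_subalgebra2[OF G adapted[OF T(1)]])
  have iii_P: "iii \<longleftrightarrow> integrable P (L T) \<and> (\<integral>\<omega>. L T \<omega> \<partial>P) = 0"
    unfolding iii_def int_P mean_P ..
  have exp_P: "(\<integral>\<^sup>+\<omega>. ennreal (exp (\<kappa> * L T \<omega>)) \<partial>P) = exp_moment M T L \<kappa>" for \<kappa>
    unfolding P_def exp_moment_def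
    using adapted[OF T(1)] by (intro nn_integral_subalgebra2[OF G]) measurable
  have no_moment: "(\<integral>\<^sup>+\<omega>. ennreal (exp (\<kappa> * L T \<omega>)) \<partial>P) = \<infinity>" if "\<kappa> \<noteq> 0" for \<kappa>
  proof -
    have "\<kappa> \<notin> {\<kappa>. exp_moment M T L \<kappa> < \<infinity>}" unfolding assms(2) using that by simp
    then show ?thesis unfolding exp_P by (simp add: less_top[symmetric])
  qed
  have P_in_C: "P \<in> C \<longleftrightarrow> iii"
    unfolding C_P iii_P by (rule P.base_measure_in_M_hat_loc_iff[OF sets_P P_at_P])
  have C_prob: "prob_space Q" "sets Q = sets P" "absolutely_continuous P Q" if "Q \<in> C" for Q
    using that unfolding C_P sets_P by (auto simp: M_hat_loc_def M_loc_def M_tilde_loc_def ac_prob_measures_def P_at_P)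
  \<comment> \<open>The infimum is 0 even when P is not in the class; it is then not attained.\<close>
  have inf: "(INF R\<in>C. relative_entropy R P) = 0"
  proof (rule antisym)
    show "0 \<le> (INF R\<in>C. relative_entropy R P)"
      by (intro INF_greatest P.relative_entropy_nonneg C_prob)
    show "(INF R\<in>C. relative_entropy R P) \<le> 0"
    proof (rule ereal_le_epsilon2)
      fix e :: real assume "0 < e"
      then obtain Z where Z: "centring_density P (L T) e Z"
        using P.exists_centring_density[OF LT no_moment] by blast
      let ?Q = "density P (\<lambda>\<omega>. ennreal (Z \<omega>))"
      have "?Q \<in> C" unfolding C_P M_hat_loc_def
        using P.centring_density_in_M_tilde_loc[where L = L and F = F, OF Z sets_P P_at_P T(2) LT] by simp
      moreover have "relative_entropy ?Q P \<le> ereal e"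
        using Z by (subst P.relative_entropy_density) (auto simp: centring_density_def)
      ultimately show "(INF R\<in>C. relative_entropy R P) \<le> 0 + ereal e"
        by (auto intro: INF_lower2)
    qed
  qed
  have memm: "is_MEMM P C Q \<longleftrightarrow> Q = P \<and> iii" for Q
    unfolding is_MEMM_def inf using P.relative_entropy_eq_0_imp[OF C_prob] P.relative_entropy_self P_in_C by metis
  have esscher0: "esscher_measure M F T L 0 = P"
    unfolding esscher_measure_def P_def[symmetric] using P.emeasure_space_1
    by (simp add: exp_P[symmetric] density_1)
  have emm: "is_EMM M F T L Q \<longleftrightarrow> Q = P \<and> iii" for Q
  proof -
    have "exp_moment M T L \<kappa> < \<infinity> \<longleftrightarrow> \<kappa> = 0" for \<kappa> using assms(2) by blast
    then have "is_EMM M F T L Q \<longleftrightarrow> Q = P \<and> martingale_on Q F T L"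
      unfolding is_EMM_def using esscher0 by simp
    then show ?thesis using P.martingale_iff_terminal_mean_zero iii_P by auto
  qed
  have all_t: "\<forall>t\<in>{0..T}. integrable M (L t) \<and> (\<integral>\<omega>. L t \<omega> \<partial>M) = 0" if iii
    using that integrable_at_time mean_at_time unfolding iii_def by simp
  show ?thesis
    unfolding Let_def P_def[symmetric] C_def[symmetric] martingale_iff_terminal_mean_zero iii_def[symmetric] memm emm
    using all_t by blast
qed

end
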